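(* Fix $f\in\mathcal D$ and $\nu_*\in M_+(E^\Delta)$ with $f(\nu_* )=\max_{\nu\in M_+(E^\Delta)}f(\nu)$. Let $A$ be the generator of a strongly continuous positive group on $C_\Delta(E)$, and assume the domain of $A$ contains both $D$ and $A(D)$. Then \[\langle A^2(\partial f(\nu_* )),\mu\rangle+\langle (A\otimes A)(\partial^2f(\nu_* )),\mu^2\rangle\le 0\] for every $\mu\in M_+(E^\Delta)$ with $\mu\le\nu_*$ and $\operatorname{supp}(\mu)\subseteq\operatorname{supp}(\nu_* )$.
   Context: $E$ is a locally compact Polish space, $E^\Delta=E\cup\{\Delta\}$ its one-point compactification ($E^\Delta=E$ if $E$ compact). $M_+(E^\Delta)$ denotes finite non-negative Borel measures on $E^\Delta$; $\mu\le\nu$ means $\nu-\mu\in M_+(E^\Delta)$. $C_\Delta(E^k)=\{f|_{E^k}: f\in C((E^\Delta)^k)\}$ with sup norm; $\widehat C_\Delta(E^k)$ the symmetric ones; $g\otimes h$ denotes the symmetrized tensor product $(g\otimes h)(x_1,\dots,x_{k+\ell})=\frac1{(k+\ell)!}\sum_{\sigma}g(x_{\sigma(1)},\dots,x_{\sigma(k)})h(x_{\sigma(k+1)},\dots,x_{\sigma(k+\ell)})$. $D\subseteq C_\Delta(E)$ is a dense linear subspace containing $1$, $D\otimes D=\operatorname{span}\{g\otimes g:g\in D\}$. For $g\in\widehat C_\Delta(E^k)$, $\langle g,\nu^k\rangle=\int g\,d\nu(x_1)\cdots d\nu(x_k)$. $\mathcal D$ is the linear span of all maps $\nu\mapsto\phi(\langle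 g_1,\nu\rangle,\dots,\langle g_m,\nu\rangle)$ with $g_i\in D$, $m\in\mathbb N_0$, and $\phi$ either a polynomial on $\mathbb R^m$ or in $C_0^\infty(\mathbb R^m)$; these are regarded as functions on $M(E^\Delta)$ by the same formula. $\partial_xf(\nu)=\lim_{\varepsilon\to0}(f(\nu+\varepsilon\delta_x)-f(\nu))/\varepsilon$ for $x\in E^\Delta$, $\partial f(\nu)=(x\mapsto\partial_xf(\nu))\in D$, $\partial^2f(\nu)=((x,y)\mapsto\partial_x\partial_yf(\nu))\in D\otimes D$. A group $(T_t)_{t\in\mathbb R}$ on $C_\Delta(E)$ is positive if $T_tg\ge0$ for all $0\le g\in C_\Delta(E)$. For a linear $A:D\to C_\Delta(E)$, $A\otimes A$ is the linear operator on $D\otimes D$ determined by $(A\otimes A)(g\otimes g)=(Ag)\otimes(Ag)$. *)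

theory Defs
  imports "HOL-Analysis.Analysis" "HOL-Probability.Probability"
begin

text \<open>Conventions. The compactification E^Delta is modelled directly as a compact metric
space, i.e. a type 'a of class metric_space with compact UNIV. C_Delta(E) is identified with
C(E^Delta) = bcontfun (bounded continuous functions, sup norm).\<close>

definition Mplus :: "'a::topological_space measure set" where
  "Mplus = {\<nu>. sets \<nu> = sets borel \<and> emeasure \<nu> (space \<nu>) < \<infinity>}"

definition meas_le :: "'a::topological_space measure \<Rightarrow> 'a measure \<Rightarrow> bool" where
  "meas_le \<mu> \<nu> \<longleftrightarrow> (\<forall>A\<in>sets borel. emeasure \<mu> A \<le> emeasure \<nu> A)"

definition supp :: "'a::topological_space measure \<Rightarrow> 'a set" where
  "supp \<nu> = {x. \<forall>U. open U \<and> x \<in> U \<longrightarrow> emeasure \<nu> U > 0}"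

text \<open>Integration functional g \<mapsto> <g, nu>; elements of the function class act on measures
only through this functional (signed perturbations nu + eps delta_x are handled by
adding eps * g x).\<close>
definition ell :: "'a::topological_space measure \<Rightarrow> ('a \<Rightarrow>\<^sub>C real) \<Rightarrow> real" where
  "ell \<nu> g = (\<integral>x. g x \<partial>\<nu>)"

definition pair2 :: "('a::topological_space \<times> 'a \<Rightarrow> real) \<Rightarrow> 'a measure \<Rightarrow> real" where
  "pair2 G \<mu> = (\<integral>x. (\<integral>y. G (x, y) \<partial>\<mu>) \<partial>\<mu>)"

text \<open>Points of R^m are represented as v :: nat \<Rightarrow> real (coordinates \<ge> m unused).\<close>

inductive_set poly_funs :: "((nat \<Rightarrow> real) \<Rightarrow> real) set" where
  pconst: "(\<lambda>v. c) \<in> poly_funs"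
| pproj: "(\<lambda>v. v i) \<in> poly_funs"
| padd: "p \<in> poly_funs \<Longrightarrow> q \<in> poly_funs \<Longrightarrow> (\<lambda>v. p v + q v) \<in> poly_funs"
| pmult: "p \<in> poly_funs \<Longrightarrow> q \<in> poly_funs \<Longrightarrow> (\<lambda>v. p v * q v) \<in> poly_funs"

definition partial_i :: "nat \<Rightarrow> ((nat \<Rightarrow> real) \<Rightarrow> real) \<Rightarrow> (nat \<Rightarrow> real) \<Rightarrow> real" where
  "partial_i i \<psi> v = deriv (\<lambda>t. \<psi> (v(i := t))) (v i)"

fun iter_partial :: "nat list \<Rightarrow> ((nat \<Rightarrow> real) \<Rightarrow> real) \<Rightarrow> (nat \<Rightarrow> real) \<Rightarrow> real" where
  "iter_partial [] \<psi> = \<psi>"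
| "iter_partial (i # is) \<psi> = partial_i i (iter_partial is \<psi>)"

definition smooth_cs :: "nat \<Rightarrow> ((nat \<Rightarrow> real) \<Rightarrow> real) \<Rightarrow> bool" where
  "smooth_cs m \<phi> \<longleftrightarrow>
     (\<forall>v w. (\<forall>i<m. v i = w i) \<longrightarrow> \<phi> v = \<phi> w) \<and>
     (\<forall>is. set is \<subseteq> {..<m} \<longrightarrow>
        continuous_on UNIV (iter_partial is \<phi>) \<and>
        (\<forall>i<m. \<forall>v. (\<lambda>t. iter_partial is \<phi> (v(i := t))) differentiable (at (v i)))) \<and>
     (\<exists>R. \<forall>v. \<phi> v \<noteq> 0 \<longrightarrow> (\<forall>i<m. \<bar>v i\<bar> \<le> R))"

definition cyl_gen :: "('a::topological_space \<Rightarrow>\<^sub>C real) set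
    \<Rightarrow> ((('a \<Rightarrow>\<^sub>C real) \<Rightarrow> real) \<Rightarrow> real) set" where
  "cyl_gen D = {F. \<exists>m g \<phi>. (\<forall>i<m. g i \<in> D) \<and> (\<phi> \<in> poly_funs \<or> smooth_cs m \<phi>) \<and>
       F = (\<lambda>l. \<phi> (\<lambda>i. if i < m then l (g i) else 0))}"

definition cylD :: "('a::topological_space \<Rightarrow>\<^sub>C real) set
    \<Rightarrow> ((('a \<Rightarrow>\<^sub>C real) \<Rightarrow> real) \<Rightarrow> real) set" where
  "cylD D = {F. \<exists>(n::nat) (c::nat \<Rightarrow> real) G. (\<forall>j<n. G j \<in> cyl_gen D) \<and> F = (\<lambda>l. \<Sum>j<n. c j * G j l)}"

text \<open>partial_x f(nu) = lim_{eps \<rightarrow> 0} (f(nu + eps delta_x) - f(nu))/eps.\<close>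
definition dder :: "((('a::topological_space \<Rightarrow>\<^sub>C real) \<Rightarrow> real) \<Rightarrow> real) \<Rightarrow> (('a \<Rightarrow>\<^sub>C real) \<Rightarrow> real) \<Rightarrow> 'a \<Rightarrow> real" where
  "dder F l x = Lim (at 0) (\<lambda>\<epsilon>. (F (\<lambda>g. l g + \<epsilon> * g x) - F l) / \<epsilon>)"

definition grad :: "((('a::topological_space \<Rightarrow>\<^sub>C real) \<Rightarrow> real) \<Rightarrow> real) \<Rightarrow> (('a \<Rightarrow>\<^sub>C real) \<Rightarrow> real)
    \<Rightarrow> ('a \<Rightarrow>\<^sub>C real)" where
  "grad F l = Bcontfun (\<lambda>x. dder F l x)"

definition hess :: "((('a::topological_space \<Rightarrow>\<^sub>C real) \<Rightarrow> real) \<Rightarrow> real) \<Rightarrow> (('a \<Rightarrow>\<^sub>C real) \<Rightarrow> real) \<Rightarrow> 'a \<times> 'a \<Rightarrow> real" where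
  "hess F l = (\<lambda>(x, y). dder (\<lambda>l'. dder F l' y) l x)"

definition strongly_continuous_group :: "(real \<Rightarrow> ('a::topological_space \<Rightarrow>\<^sub>C real) \<Rightarrow> ('a \<Rightarrow>\<^sub>C real)) \<Rightarrow> bool" where
  "strongly_continuous_group T \<longleftrightarrow>
     (\<forall>t. bounded_linear (T t)) \<and> T 0 = id \<and> (\<forall>s t. T (s + t) = T s \<circ> T t) \<and>
     (\<forall>g. continuous_on UNIV (\<lambda>t. T t g))"

definition positive_group :: "(real \<Rightarrow> ('a::topological_space \<Rightarrow>\<^sub>C real) \<Rightarrow> ('a \<Rightarrow>\<^sub>C real)) \<Rightarrow> bool" where
  "positive_group T \<longleftrightarrow> (\<forall>t (g::'a \<Rightarrow>\<^sub>C real). (\<forall>x. apply_bcontfun g x \<ge> 0) \<longrightarrow> (\<forall>x. apply_bcontfun (T t g) x \<ge> 0))"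

definition gen_dom :: "(real \<Rightarrow> ('a::topological_space \<Rightarrow>\<^sub>C real) \<Rightarrow> ('a \<Rightarrow>\<^sub>C real)) \<Rightarrow> ('a \<Rightarrow>\<^sub>C real) set" where
  "gen_dom T = {g. \<exists>L. ((\<lambda>h. (1 / h) *\<^sub>R (T h g - g)) \<longlongrightarrow> L) (at_right 0)}"

definition gen :: "(real \<Rightarrow> ('a::topological_space \<Rightarrow>\<^sub>C real) \<Rightarrow> ('a \<Rightarrow>\<^sub>C real)) \<Rightarrow> ('a \<Rightarrow>\<^sub>C real) \<Rightarrow> ('a \<Rightarrow>\<^sub>C real)" where
  "gen T g = Lim (at_right 0) (\<lambda>h. (1 / h) *\<^sub>R (T h g - g))"

text \<open>(A \<otimes> A) on D \<otimes> D, determined by (A \<otimes> A)(g \<otimes> g) = (A g) \<otimes> (A g), where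
(g \<otimes> g)(x,y) = g x * g y.\<close>
definition tensor_op :: "('a::topological_space \<Rightarrow>\<^sub>C real) set \<Rightarrow> (('a \<Rightarrow>\<^sub>C real) \<Rightarrow> ('a \<Rightarrow>\<^sub>C real))
    \<Rightarrow> ('a \<times> 'a \<Rightarrow> real) \<Rightarrow> ('a \<times> 'a \<Rightarrow> real)" where
  "tensor_op D A H = (SOME K. \<exists>(n::nat) (c::nat \<Rightarrow> real) g. (\<forall>i<n. g i \<in> D) \<and>
      H = (\<lambda>(x, y). \<Sum>i<n. c i * g i x * g i y) \<and>
      K = (\<lambda>(x, y). \<Sum>i<n. c i * A (g i) x * A (g i) y))"

end

theory Submission
  imports Defs
begin

text \<open>
  For real \<open>t\<close> put \<open>\<nu>\<^sub>t = \<nu>\<^sub>* - \<mu> + T\<^sub>t\<^sup>* \<mu>\<close>, which is a nonnegative measure because \<open>\<mu> \<le> \<nu>\<^sub>*\<close> and \<open>T\<^sub>t\<close> is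
  positive. The function \<open>t \<mapsto> f \<nu>\<^sub>t\<close>, defined for all real \<open>t\<close> since \<open>T\<close> is a group, has a maximum
  at \<open>0\<close>, and its second derivative there is the left-hand side of the claim.

  The measure \<open>T\<^sub>t\<^sup>* \<mu>\<close> is obtained without the Riesz representation theorem: as \<open>T\<^sub>t\<close> has the positive
  inverse \<open>T\<^bsub>-t\<^esub>\<close>, it preserves absolute values, so it is a weighted composition operator
  \<open>T\<^sub>t g = w \<cdot> (g \<circ> \<phi>)\<close> with \<open>w\<close> and \<open>\<phi>\<close> continuous, and \<open>T\<^sub>t\<^sup>* \<mu>\<close> is the image under \<open>\<phi>\<close> of the
  measure with density \<open>w\<close>.
\<close>

section \<open>Positive operators with positive inverse\<close>

lemma bcontfun_of_continuous:
  fixes f :: "'a::metric_space \<Rightarrow> real"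
  assumes "compact (UNIV :: 'a set)" "continuous_on UNIV f"
  obtains g :: "'a \<Rightarrow>\<^sub>C real" where "apply_bcontfun g = f"
proof -
  have "compact (range f)" using assms compact_continuous_image by blast
  then have "f \<in> bcontfun"
    using assms(2) by (simp add: bcontfun_def compact_imp_bounded)
  then show thesis using that Bcontfun_inverse by blast
qed

text \<open>Instantiated later with \<open>S = T s\<close> and \<open>R = T (- s)\<close>.
  Positivity on both sides makes \<open>S\<close> an order isomorphism, which is what forces the
  weighted composition form.\<close>

locale positive_automorphism =
  fixes S R :: "('a::metric_space \<Rightarrow>\<^sub>C real) \<Rightarrow> ('a \<Rightarrow>\<^sub>C real)"
  assumes compact_UNIV: "compact (UNIV :: 'a set)"
    and S_linear: "linear S" and R_linear: "linear R"
    and SR: "\<And>g. S (R g) = g" and RS: "\<And>g. R (S g) = g"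
    and S_pos: "\<And>g x. (\<And>x. apply_bcontfun g x \<ge> 0) \<Longrightarrow> apply_bcontfun (S g) x \<ge> 0"
    and R_pos: "\<And>g x. (\<And>x. apply_bcontfun g x \<ge> 0) \<Longrightarrow> apply_bcontfun (R g) x \<ge> 0"
begin

lemma S_mono:
  fixes g h :: "'a \<Rightarrow>\<^sub>C real"
  shows "(\<And>x. g x \<le> h x) \<Longrightarrow> S g x \<le> S h x"
  using S_pos[of "h - g" x] linear_diff[OF S_linear, of h g] by simp

lemma R_mono:
  fixes g h :: "'a \<Rightarrow>\<^sub>C real"
  shows "(\<And>x. g x \<le> h x) \<Longrightarrow> R g x \<le> R h x"
  using R_pos[of "h - g" x] linear_diff[OF R_linear, of h g] by simp

definition weight :: "'a \<Rightarrow> real" where "weight = apply_bcontfun (S (const_bcontfun 1))"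

lemma S_const: "S (const_bcontfun c) x = c * weight x"
proof -
  have "const_bcontfun c = (c *\<^sub>R const_bcontfun 1 :: 'a \<Rightarrow>\<^sub>C real)"
    by (rule bcontfun_eqI) simp
  then show ?thesis by (simp add: linear_scale[OF S_linear] weight_def)
qed

text \<open>\<open>R 1\<close> lies below the constant \<open>norm (R 1)\<close>; applying the
  monotone \<open>S\<close> gives 1 at most that constant times \<open>weight x\<close>.\<close>

lemma weight_pos: "weight x > 0"
proof -
  let ?r = "R (const_bcontfun 1)"
  have "?r y \<le> const_bcontfun (norm ?r) y" for y
    using norm_bounded[of ?r y] by simp
  then have "S ?r x \<le> norm ?r * weight x"
    using S_mono[of ?r "const_bcontfun (norm ?r)" x] by (simp add: S_const)
  then have "1 \<le> norm ?r * weight x" by (simp add: SR)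
  then show ?thesis
    by (metis norm_ge_zero not_le order_trans mult_nonneg_nonpos zero_less_one)
qed

text \<open>The bound from below is monotonicity of \<open>S\<close>. The bound from above uses the
  inverse: with \<open>k\<close> the absolute value of \<open>S g\<close>, positivity of
  \<open>R\<close> gives that \<open>R k\<close> dominates both \<open>g\<close> and
  \<open>- g\<close>, and \<open>S\<close> carries this back to \<open>k\<close>.\<close>

lemma S_abs:
  fixes g h :: "'a \<Rightarrow>\<^sub>C real"
  assumes "\<And>x. h x = \<bar>g x\<bar>"
  shows "S h x = \<bar>S g x\<bar>"
proof (rule antisym)
  obtain k :: "'a \<Rightarrow>\<^sub>C real" where k: "apply_bcontfun k = (\<lambda>x. \<bar>S g x\<bar>)"
    by (rule bcontfun_of_continuous[OF compact_UNIV, of "\<lambda>x. \<bar>S g x\<bar>"])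
      (intro continuous_intros continuous_on_apply_bcontfun)
  have "g y \<le> R k y" "- g y \<le> R k y" for y
    using R_mono[of "S g" k y] R_mono[of "- S g" k y] k linear_neg[OF R_linear, of "S g"]
    by (auto simp: RS)
  then have "h y \<le> R k y" for y
    by (smt (verit) assms)
  then show "S h x \<le> \<bar>S g x\<bar>"
    using S_mono[of h "R k" x] k by (simp add: SR)
  have "S g x \<le> S h x" "S (- g) x \<le> S h x"
    by (auto intro!: S_mono simp: assms)
  then show "\<bar>S g x\<bar> \<le> S h x"
    by (simp add: linear_neg[OF S_linear])
qed

text \<open>Otherwise every point has a neighbourhood on which some nonnegative \<open>h\<close> with
  \<open>S h x = 0\<close> is positive; a finite sum of such functions bounds a positive constant from above,
  contradicting \<open>weight x > 0\<close>.\<close>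
lemma S_eq_weighted_eval: "\<exists>y. \<forall>g. apply_bcontfun (S g) x = weight x * apply_bcontfun g y"
proof (rule ccontr)
  assume "\<not> ?thesis"
  then have no_eval: "\<forall>y. \<exists>g. apply_bcontfun (S g) x \<noteq> weight x * apply_bcontfun g y" by blast
  have "\<exists>h :: 'a \<Rightarrow>\<^sub>C real. (\<forall>z. apply_bcontfun h z \<ge> 0) \<and>
      apply_bcontfun (S h) x = 0 \<and> apply_bcontfun h y > 0" for y
  proof -
    obtain g :: "'a \<Rightarrow>\<^sub>C real" where g: "S g x \<noteq> weight x * g y" using no_eval by blast
    \<comment> \<open>The constant is chosen so that the functional \<open>S _ x\<close> vanishes on
      \<open>g'\<close>. By \<open>S_abs\<close> it then vanishes on the absolute value of
      \<open>g'\<close> too, which is positive at \<open>y\<close> by the choice of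
      \<open>g\<close>.\<close>
    define g' where "g' = g - const_bcontfun (S g x / weight x)"
    have [simp]: "S g' x = 0"
      using weight_pos[of x] by (simp add: g'_def linear_diff[OF S_linear] S_const)
    obtain h :: "'a \<Rightarrow>\<^sub>C real" where h: "apply_bcontfun h = (\<lambda>z. \<bar>g' z\<bar>)"
      by (rule bcontfun_of_continuous[OF compact_UNIV, of "\<lambda>z. \<bar>g' z\<bar>"])
        (intro continuous_intros continuous_on_apply_bcontfun)
    have "g' y \<noteq> 0" using g weight_pos[of x] by (auto simp: g'_def field_simps)
    then show ?thesis using S_abs[of h g' x] h by (intro exI[of _ h]) auto
  qed
  then obtain h :: "'a \<Rightarrow> 'a \<Rightarrow>\<^sub>C real" where h: "\<And>y z. h y z \<ge> 0"
    "\<And>y. apply_bcontfun (S (h y)) x = 0" "\<And>y. h y y > 0"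
    by metis
  define U where "U y = {z. h y z > 0}" for y
  have "open (U y)" for y
    unfolding U_def by (intro open_Collect_less continuous_intros) auto
  then obtain Y where Y: "finite Y" "UNIV \<subseteq> (\<Union>y\<in>Y. U y)"
    using compactE_image[OF compact_UNIV, of UNIV U] h(3) unfolding U_def
    by (metis (no_types, lifting) UNIV_I UN_I mem_Collect_eq subsetI)
  define H where "H = (\<Sum>y\<in>Y. h y)"
  have H: "H z = (\<Sum>y\<in>Y. h y z)" for z
    unfolding H_def by (induction Y rule: infinite_finite_induct) auto
  have H_pos: "H z > 0" for z
  proof -
    obtain y where "y \<in> Y" "h y z > 0" using Y(2) unfolding U_def by auto
    then show ?thesis unfolding H using Y(1) h(1) by (intro sum_pos2) auto
  qed
  have "S H x = 0"
    unfolding H_def linear_sum[OF S_linear]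
    using h(2) by (induction Y rule: infinite_finite_induct) auto
  moreover obtain z0 where z0: "\<And>z. H z0 \<le> H z"
    using continuous_attains_inf[OF compact_UNIV _ continuous_on_apply_bcontfun, of H] by auto
  have "S (const_bcontfun (H z0)) x \<le> S H x" by (rule S_mono) (simp add: z0)
  ultimately show False
    using H_pos[of z0] weight_pos[of x] by (simp add: S_const mult_le_0_iff)
qed

definition flow :: "'a \<Rightarrow> 'a" where "flow x = (SOME y. \<forall>g. apply_bcontfun (S g) x = weight x * apply_bcontfun g y)"

lemma S_eq: "apply_bcontfun (S g) x = weight x * apply_bcontfun g (flow x)"
  using someI_ex[OF S_eq_weighted_eval[of x]] unfolding flow_def by blast

lemma continuous_weight: "continuous_on UNIV weight"
  unfolding weight_def by auto

text \<open>Testing \<open>S\<close> on the distance to \<open>flow x0\<close> and dividing by the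
  weight shows that the distance from \<open>flow x\<close> to \<open>flow x0\<close> is continuous
  in \<open>x\<close>; it vanishes at \<open>x0\<close>.\<close>

lemma continuous_flow: "continuous_on UNIV flow"
  unfolding continuous_on_def
proof
  fix x0
  obtain g :: "'a \<Rightarrow>\<^sub>C real" where g: "apply_bcontfun g = (\<lambda>z. dist z (flow x0))"
    by (rule bcontfun_of_continuous[OF compact_UNIV, of "\<lambda>z. dist z (flow x0)"])
      (intro continuous_intros)
  have "continuous_on UNIV (\<lambda>x. S g x / weight x)"
    using weight_pos by (intro continuous_intros continuous_weight) (auto simp: less_le)
  then have "continuous_on UNIV (\<lambda>x. dist (flow x) (flow x0))"
    using weight_pos by (simp add: S_eq g less_imp_neq[symmetric])
  then have "((\<lambda>x. dist (flow x) (flow x0)) \<longlongrightarrow> 0) (at x0)"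
    unfolding continuous_on_def by (metis UNIV_I dist_self)
  then show "(flow \<longlongrightarrow> flow x0) (at x0)"
    by (rule tendsto_dist_iff[THEN iffD2])
qed

end

section \<open>Finite measures\<close>

lemma space_Mplus:
  fixes \<mu> :: "'a::topological_space measure"
  shows "\<mu> \<in> Mplus \<Longrightarrow> space \<mu> = UNIV"
  by (auto simp: Mplus_def dest: sets_eq_imp_space_eq)

lemma ell_integrable:
  fixes \<mu> :: "'a::metric_space measure" and g :: "'a \<Rightarrow>\<^sub>C real"
  assumes "\<mu> \<in> Mplus" shows "integrable \<mu> (apply_bcontfun g)"
proof -
  interpret finite_measure \<mu>
    using assms by (intro finite_measureI) (auto simp: Mplus_def)
  have "apply_bcontfun g \<in> borel_measurable \<mu>"
    using assms borel_measurable_continuous_onI[OF continuous_on_apply_bcontfun, of g]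
    by (simp add: Mplus_def cong: measurable_cong_sets)
  moreover have "AE x in \<mu>. norm (g x) \<le> norm g" by (intro AE_I2 norm_bounded)
  ultimately show ?thesis by (intro integrable_const_bound)
qed

lemma bounded_linear_ell:
  fixes \<mu> :: "'a::metric_space measure"
  assumes "\<mu> \<in> Mplus" shows "bounded_linear (ell \<mu>)"
proof (rule bounded_linear_intro)
  interpret finite_measure \<mu>
    using assms by (intro finite_measureI) (auto simp: Mplus_def)
  note [simp] = ell_integrable[OF assms]
  show "ell \<mu> (g + h) = ell \<mu> g + ell \<mu> h" for g h by (simp add: ell_def)
  show "ell \<mu> (c *\<^sub>R g) = c *\<^sub>R ell \<mu> g" for c g by (simp add: ell_def)
  show "norm (ell \<mu> g) \<le> norm g * measure \<mu> (space \<mu>)" for g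
  proof -
    have "norm (ell \<mu> g) \<le> (\<integral>x. norm (g x) \<partial>\<mu>)" unfolding ell_def by simp
    also have "\<dots> \<le> (\<integral>x. norm g \<partial>\<mu>)"
      by (intro integral_mono integrable_norm) (auto intro: norm_bounded[of g, simplified])
    finally show ?thesis by (simp add: mult.commute)
  qed
qed

section \<open>Sums and differences of finite measures\<close>

definition add_measure :: "'a measure \<Rightarrow> 'a measure \<Rightarrow> 'a measure" where
  "add_measure M N = measure_of (space M) (sets M) (\<lambda>A. emeasure M A + emeasure N A)"

lemma space_add_measure [simp]: "space (add_measure M N) = space M"
  and sets_add_measure [simp]: "sets (add_measure M N) = sets M"
  by (auto simp: add_measure_def)

lemma emeasure_add_measure:
  assumes "sets M = sets N" "A \<in> sets M"
  shows "emeasure (add_measure M N) A = emeasure M A + emeasure N A"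
  unfolding add_measure_def
proof (rule emeasure_measure_of_sigma)
  show "sigma_algebra (space M) (sets M)" ..
  show "positive (sets M) (\<lambda>A. emeasure M A + emeasure N A)" by (simp add: positive_def)
  show "countably_additive (sets M) (\<lambda>A. emeasure M A + emeasure N A)"
  proof (rule countably_additiveI)
    fix A :: "nat \<Rightarrow> 'a set"
    assume A: "range A \<subseteq> sets M" "disjoint_family A"
    have "(\<Sum>i. emeasure M (A i) + emeasure N (A i)) = (\<Sum>i. emeasure M (A i)) + (\<Sum>i. emeasure N (A i))"
      by (rule suminf_add[symmetric]) auto
    also have "\<dots> = emeasure M (\<Union>i. A i) + emeasure N (\<Union>i. A i)"
      using A assms(1) by (simp add: suminf_emeasure)
    finally show "(\<Sum>i. emeasure M (A i) + emeasure N (A i)) = emeasure M (\<Union>i. A i) + emeasure N (\<Union>i. A i)" .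
  qed
qed (fact assms(2))

lemma nn_integral_add_measure:
  assumes sets: "sets M = sets N" and f: "f \<in> borel_measurable M"
  shows "(\<integral>\<^sup>+x. f x \<partial>add_measure M N) = (\<integral>\<^sup>+x. f x \<partial>M) + (\<integral>\<^sup>+x. f x \<partial>N)"
proof -
  have meas: "borel_measurable (add_measure M N) = (borel_measurable M :: ('a \<Rightarrow> ennreal) set)"
    "borel_measurable N = (borel_measurable M :: ('a \<Rightarrow> ennreal) set)"
    by (rule measurable_cong_sets; simp add: sets)+
  from f show ?thesis
  proof induction
    case (cong f g)
    have "(\<integral>\<^sup>+x. f x \<partial>L) = (\<integral>\<^sup>+x. g x \<partial>L)" if "space L = space M" for L
      using cong(3) that by (intro nn_integral_cong) simp
    from this[of M] this[of N] this[of "add_measure M N"] show ?case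
      using cong(4) sets_eq_imp_space_eq[OF sets] by simp
  next
    case (set A)
    then show ?case by (simp add: sets emeasure_add_measure[OF sets])
  next
    case (mult u c)
    then show ?case by (simp only: nn_integral_cmult meas distrib_left)
  next
    case (add u v)
    then show ?case by (simp add: nn_integral_add meas add.assoc add.left_commute)
  next
    case (seq U)
    then have "incseq (\<lambda>i. \<integral>\<^sup>+x. U i x \<partial>L)" for L :: "'a measure"
      by (auto simp: incseq_def le_fun_def intro!: nn_integral_mono)
    with seq show ?case
      by (simp add: nn_integral_monotone_convergence_SUP meas ennreal_SUP_add image_comp)
  qed
qed

lemma ell_add_measure:
  fixes M N :: "'a::metric_space measure"
  assumes "M \<in> Mplus" "N \<in> Mplus"
  shows "add_measure M N \<in> Mplus" "ell (add_measure M N) g = ell M g + ell N g"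
proof -
  have sets: "sets M = sets N" using assms by (simp add: Mplus_def)
  show *: "add_measure M N \<in> Mplus"
    using assms emeasure_add_measure[OF sets, of "space M"] space_Mplus[of M] space_Mplus[of N]
    by (simp add: Mplus_def ennreal_add_eq_top flip: less_top)
  have nonneg: "ell (add_measure M N) h = ell M h + ell N h" if "\<And>x. h x \<ge> 0" for h :: "'a \<Rightarrow>\<^sub>C real"
  proof -
    have "ennreal (ell (add_measure M N) h) = (\<integral>\<^sup>+x. h x \<partial>add_measure M N)"
      using nn_integral_eq_integral[OF ell_integrable[OF *, of h]] that by (simp add: ell_def)
    also have "\<dots> = (\<integral>\<^sup>+x. h x \<partial>M) + (\<integral>\<^sup>+x. h x \<partial>N)"
      using borel_measurable_integrable[OF ell_integrable[OF assms(1), of h]]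
      by (intro nn_integral_add_measure sets) measurable
    also have "\<dots> = ennreal (ell M h + ell N h)"
      using nn_integral_eq_integral[OF ell_integrable, of _ h] assms that
      by (simp add: ell_def ennreal_plus)
    finally show ?thesis
      using that by (subst (asm) ennreal_inj) (auto simp: ell_def)
  qed
  \<comment> \<open>Shifting \<open>g\<close> by its norm makes it nonnegative, so the general case
    follows from the nonnegative one by linearity of each integral.\<close>
  have "g + const_bcontfun (norm g) = h \<Longrightarrow> h x \<ge> 0" for h :: "'a \<Rightarrow>\<^sub>C real" and x
    using norm_bounded[of g x] by (auto simp: abs_le_iff)
  then have "ell (add_measure M N) (g + const_bcontfun (norm g)) =
      ell M (g + const_bcontfun (norm g)) + ell N (g + const_bcontfun (norm g))"
    using nonneg by blast
  moreover have "ell (add_measure M N) (const_bcontfun (norm g)) =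
      ell M (const_bcontfun (norm g)) + ell N (const_bcontfun (norm g))"
    by (rule nonneg) simp
  ultimately show "ell (add_measure M N) g = ell M g + ell N g"
    using assms * by (simp add: linear_add bounded_linear.linear bounded_linear_ell)
qed

lemma add_diff_measure:
  fixes \<nu> \<mu> :: "'a::metric_space measure"
  assumes "\<nu> \<in> Mplus" "\<mu> \<in> Mplus" "meas_le \<mu> \<nu>"
  shows "diff_measure \<nu> \<mu> \<in> Mplus" "ell (diff_measure \<nu> \<mu>) g = ell \<nu> g - ell \<mu> g"
proof -
  have fin: "finite_measure \<nu>" "finite_measure \<mu>"
    using assms by (auto intro!: finite_measureI simp: Mplus_def)
  have sets: "sets \<nu> = sets \<mu>" using assms by (simp add: Mplus_def)
  have le: "emeasure \<mu> A \<le> emeasure \<nu> A" if "A \<in> sets \<mu>" for A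
    using that assms by (auto simp: Mplus_def meas_le_def)
  have em: "emeasure (diff_measure \<nu> \<mu>) A = emeasure \<nu> A - emeasure \<mu> A" if "A \<in> sets \<nu>" for A
    using that le sets by (intro emeasure_diff_measure fin) auto
  show *: "diff_measure \<nu> \<mu> \<in> Mplus"
    using assms em[of "space \<nu>"] space_Mplus[OF assms(1)]
    by (auto simp: Mplus_def ennreal_minus_eq_top simp flip: less_top)
  \<comment> \<open>Adding \<open>\<mu>\<close> back turns the formula for the difference into the
    known one for sums; truncated subtraction in \<open>ennreal\<close> is harmless because
    \<open>\<mu>\<close> lies below \<open>\<nu>\<close>.\<close>
  have "add_measure (diff_measure \<nu> \<mu>) \<mu> = \<nu>"
  proof (rule measure_eqI)
    fix A assume "A \<in> sets (add_measure (diff_measure \<nu> \<mu>) \<mu>)"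
    then have "A \<in> sets \<nu>" "A \<in> sets \<mu>" using sets by auto
    then show "emeasure (add_measure (diff_measure \<nu> \<mu>) \<mu>) A = emeasure \<nu> A"
      using le by (subst emeasure_add_measure) (auto simp: em sets intro!: diff_add_cancel_ennreal)
  qed simp
  then show "ell (diff_measure \<nu> \<mu>) g = ell \<nu> g - ell \<mu> g"
    using ell_add_measure(2)[OF * assms(2), of g] by simp
qed

text \<open>Provides the adjoint of \<open>S\<close> on measures. With \<open>S_eq\<close> the
  identity is a change of variables, and the total mass of the image is the integral of the bounded
  function \<open>weight\<close>.\<close>

lemma (in positive_automorphism) pushforward:
  assumes "\<mu> \<in> Mplus"
  shows "\<exists>\<nu>\<in>Mplus. \<forall>g. ell \<nu> g = ell \<mu> (S g)"
proof (intro bexI allI)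
  have sets: "sets \<mu> = sets borel" using assms by (simp add: Mplus_def)
  have w: "weight \<in> borel_measurable \<mu>"
    using borel_measurable_continuous_onI[OF continuous_weight]
    by (simp cong: measurable_cong_sets add: sets)
  have fl: "flow \<in> measurable \<mu> borel"
    using borel_measurable_continuous_onI[OF continuous_flow]
    by (simp cong: measurable_cong_sets add: sets)
  let ?N = "distr (density \<mu> (\<lambda>x. ennreal (weight x))) borel flow"
  show "ell ?N g = ell \<mu> (S g)" for g
    using w fl weight_pos
    by (simp add: ell_def integral_distr borel_measurable_continuous_onI integral_density
        S_eq less_imp_le measurable_compose)
  have "integrable \<mu> weight"
    unfolding weight_def by (rule ell_integrable[OF assms])
  then have "(\<integral>\<^sup>+x. weight x \<partial>\<mu>) < \<infinity>"
    using weight_pos by (simp add: nn_integral_eq_integral less_imp_le)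
  moreover have "emeasure ?N (space ?N) = (\<integral>\<^sup>+x. weight x \<partial>\<mu>)"
    using w fl
    by (subst emeasure_distr)
      (auto simp: emeasure_density intro!: nn_integral_cong)
  ultimately show "?N \<in> Mplus" by (simp add: Mplus_def)
qed

section \<open>The generator of a positive group\<close>

lemma gen_tendsto:
  assumes "g \<in> gen_dom T"
  shows "((\<lambda>h. (1 / h) *\<^sub>R (T h g - g)) \<longlongrightarrow> gen T g) (at_right 0)"
  using assms tendsto_Lim[of "at_right (0::real)"] trivial_limit_at_right_real
  unfolding gen_dom_def gen_def by blast

text \<open>A positive operator is controlled by its value at the constant 1, because
  \<open>norm g\<close> times 1 dominates both \<open>g\<close> and \<open>- g\<close>. For a group
  this bound depends on time only through the orbit of 1.\<close>

lemma norm_positive_operator_le: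
  fixes S :: "('a::topological_space \<Rightarrow>\<^sub>C real) \<Rightarrow> ('a \<Rightarrow>\<^sub>C real)"
  assumes lin: "linear S"
    and pos: "\<And>g x. (\<And>x. apply_bcontfun g x \<ge> 0) \<Longrightarrow> apply_bcontfun (S g) x \<ge> 0"
  shows "norm (S g) \<le> norm g * norm (S (const_bcontfun 1))"
proof (rule norm_bound)
  fix x
  let ?e = "const_bcontfun 1 :: 'a \<Rightarrow>\<^sub>C real"
  have "0 \<le> norm g - g y" "0 \<le> norm g + g y" for y using norm_bounded[of g y] by auto
  then have "0 \<le> apply_bcontfun (S (norm g *\<^sub>R ?e - g)) x" "0 \<le> apply_bcontfun (S (norm g *\<^sub>R ?e + g)) x"
    by (auto intro!: pos)
  then have "\<bar>S g x\<bar> \<le> norm g * S ?e x"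
    by (simp add: linear_diff[OF lin] linear_add[OF lin] linear_scale[OF lin] abs_le_iff)
  also have "\<dots> \<le> norm g * norm (S ?e)"
    using norm_bounded[of "S ?e" x] by (intro mult_left_mono) auto
  finally show "norm (S g x) \<le> norm g * norm (S ?e)" by simp
qed

text \<open>Joint continuity in time and argument. Split \<open>z h\<close> into
  \<open>z h - z0\<close> and \<open>z0\<close>: the second part converges by strong continuity, and
  the first tends to 0 because \<open>T (s h)\<close> applied to 1 converges and so has convergent
  norm.\<close>

lemma tendsto_positive_group_apply:
  fixes z :: "real \<Rightarrow> ('a::topological_space \<Rightarrow>\<^sub>C real)"
  assumes T: "strongly_continuous_group T" "positive_group T"
    and z: "(z \<longlongrightarrow> z0) F" and s: "(s \<longlongrightarrow> t) F"
  shows "((\<lambda>h. T (s h) (z h)) \<longlongrightarrow> T t z0) F"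
proof -
  have lin: "linear (T r)" for r
    using T by (simp add: strongly_continuous_group_def bounded_linear.linear)
  have cont: "((\<lambda>h. T (s h) g) \<longlongrightarrow> T t g) F" for g
    using T(1) by (intro continuous_on_tendsto_compose[OF _ s, of UNIV])
      (auto simp: strongly_continuous_group_def)
  have "((\<lambda>h. norm (z h - z0) * norm (T (s h) (const_bcontfun 1))) \<longlongrightarrow>
      norm (z0 - z0) * norm (T t (const_bcontfun 1))) F"
    by (intro tendsto_intros z cont)
  then have "((\<lambda>h. norm (z h - z0) * norm (T (s h) (const_bcontfun 1))) \<longlongrightarrow> 0) F" by simp
  then have "((\<lambda>h. T (s h) (z h - z0)) \<longlongrightarrow> 0) F"
  proof (rule Lim_null_comparison[OF always_eventually, rotated], intro allI)
    show "norm (T (s h) (z h - z0)) \<le> norm (z h - z0) * norm (T (s h) (const_bcontfun 1))" for h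
      using T(2) by (intro norm_positive_operator_le lin) (simp add: positive_group_def)
  qed
  from tendsto_add[OF this cont[of z0]] show ?thesis
    by (simp add: linear_diff[OF lin])
qed

text \<open>The generator is a limit from the right at time 0; the group law moves it to a two-sided
  derivative at any \<open>t\<close>. From the right the fixed operator \<open>T t\<close> acts on
  the difference quotient. From the left it is \<open>T (t - h)\<close>, which varies with
  \<open>h\<close>, so joint continuity is used.\<close>

lemma group_has_vector_derivative:
  fixes T :: "real \<Rightarrow> ('a::topological_space \<Rightarrow>\<^sub>C real) \<Rightarrow> ('a \<Rightarrow>\<^sub>C real)"
  assumes T: "strongly_continuous_group T" "positive_group T" and g: "g \<in> gen_dom T"
  shows "((\<lambda>t. T t g) has_vector_derivative T t (gen T g)) (at t)"
proof -
  have lin: "linear (T s)" and T_add: "T (r + s) = T r \<circ> T s" for r s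
    using T by (auto simp: strongly_continuous_group_def bounded_linear.linear)
  let ?d = "\<lambda>h. (1 / h) *\<^sub>R (T h g - g)"
  have lim: "(?d \<longlongrightarrow> gen T g) (at_right 0)" by (rule gen_tendsto[OF g])
  have "((\<lambda>h. T t (?d h)) \<longlongrightarrow> T t (gen T g)) (at_right 0)"
    by (rule tendsto_positive_group_apply[OF T lim tendsto_const])
  moreover have "T t (?d h) = (1 / h) *\<^sub>R (T (t + h) g - T t g)" for h
    by (simp add: linear_scale[OF lin] linear_diff[OF lin] T_add)
  ultimately have right: "((\<lambda>h. (1 / h) *\<^sub>R (T (t + h) g - T t g)) \<longlongrightarrow> T t (gen T g)) (at_right 0)"
    by simp
  have "((\<lambda>h. t - h) \<longlongrightarrow> t - 0) (at_right 0)" by (intro tendsto_intros)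
  then have "((\<lambda>h. T (t - h) (?d h)) \<longlongrightarrow> T t (gen T g)) (at_right 0)"
    by (intro tendsto_positive_group_apply[OF T lim]) simp
  moreover have "T (t - h) (?d h) = (1 / (- h)) *\<^sub>R (T (t + - h) g - T t g)" for h
    using T_add[of "t - h" h] by (simp add: linear_scale[OF lin] linear_diff[OF lin] algebra_simps)
  ultimately have "((\<lambda>h. (1 / (- h)) *\<^sub>R (T (t + - h) g - T t g)) \<longlongrightarrow> T t (gen T g)) (at_right 0)"
    by simp
  then have left: "((\<lambda>h. (1 / h) *\<^sub>R (T (t + h) g - T t g)) \<longlongrightarrow> T t (gen T g)) (at_left 0)"
    unfolding at_left_minus[of 0] by (simp add: filterlim_filtermap)
  from left right have "((\<lambda>h. (1 / h) *\<^sub>R (T (t + h) g - T t g)) \<longlongrightarrow> T t (gen T g)) (at 0)"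
    by (rule filterlim_split_at)
  then have "((\<lambda>h. norm ((1 / h) *\<^sub>R (T (t + h) g - T t g) - T t (gen T g))) \<longlongrightarrow> 0) (at 0)"
    by (simp add: LIM_zero tendsto_norm_zero)
  then have "((\<lambda>h. norm (T (t + h) g - T t g - h *\<^sub>R T t (gen T g)) / norm h) \<longlongrightarrow> 0) (at 0)"
  proof (rule Lim_transform_eventually)
    show "\<forall>\<^sub>F h in at 0. norm ((1 / h) *\<^sub>R (T (t + h) g - T t g) - T t (gen T g)) =
        norm (T (t + h) g - T t g - h *\<^sub>R T t (gen T g)) / norm h"
    proof (rule eventually_mono)
      show "\<forall>\<^sub>F h in at 0. h \<noteq> (0::real)" by (simp add: eventually_at_filter)
      fix h :: real assume "h \<noteq> 0"
      then have "(1 / h) *\<^sub>R (T (t + h) g - T t g) - T t (gen T g) =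
          (1 / h) *\<^sub>R (T (t + h) g - T t g - h *\<^sub>R T t (gen T g))"
        by (simp add: scaleR_diff_right)
      then show "norm ((1 / h) *\<^sub>R (T (t + h) g - T t g) - T t (gen T g)) =
          norm (T (t + h) g - T t g - h *\<^sub>R T t (gen T g)) / norm h"
        by (simp only: norm_scaleR) simp
    qed
  qed
  then show ?thesis
    unfolding has_vector_derivative_def has_derivative_at
    by (simp add: bounded_linear_scaleR_left)
qed

section \<open>Partial derivatives in finitely many coordinates\<close>

text \<open>Here \<open>a\<close> and \<open>b\<close> come in any order and may coincide, as
  happens for a coordinate of a curve near its base point.\<close>

lemma mvt_between:
  fixes f :: "real \<Rightarrow> real"
  assumes "\<And>s. (f has_real_derivative f' s) (at s)"
  shows "\<exists>\<xi>. min a b \<le> \<xi> \<and> \<xi> \<le> max a b \<and> f b - f a = f' \<xi> * (b - a)"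
proof -
  consider "a < b" | "a = b" | "b < a" by linarith
  then show ?thesis
  proof cases
    case 1
    obtain z where "a < z" "z < b" "f b - f a = (b - a) * f' z"
      using MVT2[OF 1, of f f'] assms by auto
    then show ?thesis by (intro exI[of _ z]) auto
  next
    case 2
    then show ?thesis by auto
  next
    case 3
    obtain z where "b < z" "z < a" "f a - f b = (a - b) * f' z"
      using MVT2[OF 3, of f f'] assms by auto
    then show ?thesis by (intro exI[of _ z]) (auto simp: algebra_simps)
  qed
qed

text \<open>Schwarz's theorem. The second difference of \<open>f\<close> over a square of side
  \<open>h\<close> is evaluated by two mean value theorems, in either order of the variables. Hence
  \<open>f12\<close> and \<open>f21\<close> agree at some pair of points of each square, and these
  points converge to the corner as \<open>h\<close> tends to 0.\<close>

lemma mixed_partials_eq: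
  fixes f f1 f2 f12 f21 :: "real \<Rightarrow> real \<Rightarrow> real"
  assumes f1: "\<And>s t. ((\<lambda>s. f s t) has_real_derivative f1 s t) (at s)"
    and f2: "\<And>s t. ((\<lambda>t. f s t) has_real_derivative f2 s t) (at t)"
    and f12: "\<And>s t. ((\<lambda>t. f1 s t) has_real_derivative f12 s t) (at t)"
    and f21: "\<And>s t. ((\<lambda>s. f2 s t) has_real_derivative f21 s t) (at s)"
    and cont: "continuous_on UNIV (\<lambda>(s, t). f12 s t)" "continuous_on UNIV (\<lambda>(s, t). f21 s t)"
  shows "f12 a b = f21 a b"
proof -
  have ex: "\<exists>s t s' t'. a \<le> s \<and> s \<le> a + h \<and> b \<le> t \<and> t \<le> b + h \<and>
      a \<le> s' \<and> s' \<le> a + h \<and> b \<le> t' \<and> t' \<le> b + h \<and> f12 s t = f21 s' t'" if h: "h > 0" for h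
  proof -
    obtain s where s: "a \<le> s" "s \<le> a + h"
        "(f (a + h) (b + h) - f (a + h) b) - (f a (b + h) - f a b) = (f1 s (b + h) - f1 s b) * h"
      using mvt_between[of "\<lambda>s. f s (b + h) - f s b" "\<lambda>s. f1 s (b + h) - f1 s b" a "a + h",
          OF DERIV_diff[OF f1 f1]] h by auto
    obtain t where t: "b \<le> t" "t \<le> b + h" "f1 s (b + h) - f1 s b = f12 s t * h"
      using mvt_between[of "\<lambda>t. f1 s t" "\<lambda>t. f12 s t" b "b + h"] h f12 by auto
    obtain t' where t': "b \<le> t'" "t' \<le> b + h"
        "(f (a + h) (b + h) - f a (b + h)) - (f (a + h) b - f a b) = (f2 (a + h) t' - f2 a t') * h"
      using mvt_between[of "\<lambda>t. f (a + h) t - f a t" "\<lambda>t. f2 (a + h) t - f2 a t" b "b + h",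
          OF DERIV_diff[OF f2 f2]] h by auto
    obtain s' where s': "a \<le> s'" "s' \<le> a + h" "f2 (a + h) t' - f2 a t' = f21 s' t' * h"
      using mvt_between[of "\<lambda>s. f2 s t'" "\<lambda>s. f21 s t'" a "a + h"] h f21 by auto
    have "f12 s t * h * h = f21 s' t' * h * h"
      using s(3)[unfolded t(3)] t'(3)[unfolded s'(3)] by linarith
    then show ?thesis using h s t s' t' by (metis mult_cancel_right less_irrefl)
  qed
  then obtain s t s' t' where P: "\<And>h. h > 0 \<Longrightarrow> a \<le> s h \<and> s h \<le> a + h \<and> b \<le> t h \<and> t h \<le> b + h \<and>
      a \<le> s' h \<and> s' h \<le> a + h \<and> b \<le> t' h \<and> t' h \<le> b + h \<and> f12 (s h) (t h) = f21 (s' h) (t' h)"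
    by metis
  have ev: "\<forall>\<^sub>F h in at_right 0. (h::real) > 0"
    by (simp add: eventually_at_right_less)
  have squeeze: "(u \<longlongrightarrow> c) (at_right 0)" if "\<And>h. h > 0 \<Longrightarrow> c \<le> u h \<and> u h \<le> c + h"
    for u :: "real \<Rightarrow> real" and c
  proof (rule tendsto_sandwich[of "\<lambda>_. c" u _ "\<lambda>h. c + h"])
    have "((\<lambda>h. c + h) \<longlongrightarrow> c + 0) (at_right 0)" by (intro tendsto_intros)
    then show "((\<lambda>h. c + h) \<longlongrightarrow> c) (at_right 0)" by simp
  qed (use ev that in \<open>auto elim!: eventually_mono\<close>)
  have "((\<lambda>h. (s h, t h)) \<longlongrightarrow> (a, b)) (at_right 0)" "((\<lambda>h. (s' h, t' h)) \<longlongrightarrow> (a, b)) (at_right 0)"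
    using P by (auto intro!: tendsto_Pair squeeze)
  then have "((\<lambda>h. f12 (s h) (t h)) \<longlongrightarrow> f12 a b) (at_right 0)"
    and lim21: "((\<lambda>h. f21 (s' h) (t' h)) \<longlongrightarrow> f21 a b) (at_right 0)"
    using continuous_on_tendsto_compose[OF cont(1), of _ "(a, b)"]
      continuous_on_tendsto_compose[OF cont(2), of _ "(a, b)"] by fastforce+
  note this(1)
  moreover have "\<forall>\<^sub>F h in at_right 0. f12 (s h) (t h) = f21 (s' h) (t' h)"
    using ev P by (auto elim!: eventually_mono)
  ultimately have "((\<lambda>h. f21 (s' h) (t' h)) \<longlongrightarrow> f12 a b) (at_right 0)"
    by (rule Lim_transform_eventually)
  with lim21 show ?thesis
    using tendsto_unique[OF trivial_limit_at_right_real] by blast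
qed

section \<open>Partial derivatives and the chain rule on sequences of reals\<close>

definition has_partial :: "((nat \<Rightarrow> real) \<Rightarrow> real) \<Rightarrow> nat \<Rightarrow> ((nat \<Rightarrow> real) \<Rightarrow> real) \<Rightarrow> bool" where
  "has_partial \<phi> i p \<longleftrightarrow> (\<forall>v. ((\<lambda>t. \<phi> (v(i := t))) has_real_derivative p v) (at (v i)))"

lemma has_partialD:
  "has_partial \<phi> i p \<Longrightarrow> ((\<lambda>t. \<phi> (v(i := t))) has_real_derivative p (v(i := s))) (at s)"
  unfolding has_partial_def by (drule spec[of _ "v(i := s)"]) simp

text \<open>For distinct indices this is Schwarz's theorem in the plane of the two coordinates; for
  equal indices it is uniqueness of derivatives.\<close>

lemma has_partial_commute:
  assumes "has_partial \<phi> i p" "has_partial \<phi> j q" "has_partial p j pq" "has_partial q i qp"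
    and "continuous_on UNIV pq" "continuous_on UNIV qp"
  shows "pq v = qp v"
proof (cases "i = j")
  case True
  have "p = q"
  proof
    show "p v = q v" for v
      using has_partialD[OF assms(1), of v "v i"] has_partialD[OF assms(2), of v "v i"] True
      by (auto dest: DERIV_unique)
  qed
  then show ?thesis
    using has_partialD[OF assms(3), of v "v i"] has_partialD[OF assms(4), of v "v i"] True
    by (auto dest: DERIV_unique)
next
  case False
  let ?w = "\<lambda>s t. v(i := s, j := t)"
  have swap: "?w s t = v(j := t, i := s)" for s t
    using False by (rule fun_upd_twist)
  have cont: "continuous_on UNIV (\<lambda>(s, t). g (?w s t))" if "continuous_on UNIV g"
    for g :: "(nat \<Rightarrow> real) \<Rightarrow> real"
  proof -
    have "continuous_on UNIV (\<lambda>x. ?w (fst x) (snd x) n)" for n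
      by (cases "n = j"; cases "n = i") (auto intro!: continuous_intros)
    then have "continuous_on UNIV (\<lambda>x. ?w (fst x) (snd x))"
      by (intro continuous_on_coordinatewise_then_product)
    then show ?thesis
      unfolding case_prod_beta by (rule continuous_on_compose2[OF that]) simp
  qed
  have "pq (?w (v i) (v j)) = qp (?w (v i) (v j))"
  proof (rule mixed_partials_eq[where f = "\<lambda>s t. \<phi> (?w s t)" and ?f1.0 = "\<lambda>s t. p (?w s t)"
        and ?f2.0 = "\<lambda>s t. q (?w s t)" and ?f12.0 = "\<lambda>s t. pq (?w s t)"
        and ?f21.0 = "\<lambda>s t. qp (?w s t)"])
    show "((\<lambda>s. \<phi> (?w s t)) has_real_derivative p (?w s t)) (at s)" for s t
      unfolding swap by (rule has_partialD[OF assms(1)])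
    show "((\<lambda>s. q (?w s t)) has_real_derivative qp (?w s t)) (at s)" for s t
      unfolding swap by (rule has_partialD[OF assms(4)])
  qed (auto intro!: has_partialD assms cont)
  then show ?thesis by simp
qed

lemma tendsto_fun_iff:
  fixes l :: "'i \<Rightarrow> 'b::topological_space"
  shows "(f \<longlongrightarrow> l) F \<longleftrightarrow> (\<forall>i. ((\<lambda>c. f c i) \<longlongrightarrow> l i) F)"
  using limitin_componentwise[of "\<lambda>_. euclidean" UNIV f l F]
  by (simp add: euclidean_product_topology limitin_canonical_iff)

text \<open>Only continuous partial derivatives are given, so the coordinates are moved one at a
  time: in \<open>W k t\<close> the first \<open>k\<close> are taken at time \<open>t\<close>, the
  others at \<open>t0\<close>. Each increment is handled by the mean value theorem in a single
  coordinate.\<close>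

lemma chain_rule_coordinates:
  assumes p: "\<And>i. i < m \<Longrightarrow> has_partial \<phi> i (p i)" "\<And>i. i < m \<Longrightarrow> continuous_on UNIV (p i)"
    and V: "\<And>i. i < m \<Longrightarrow> ((\<lambda>t. V t i) has_real_derivative d i) (at t0)"
    and fixed: "\<And>t i. i \<ge> m \<Longrightarrow> V t i = V t0 i"
  shows "((\<lambda>t. \<phi> (V t)) has_real_derivative (\<Sum>i<m. p i (V t0) * d i)) (at t0)"
proof -
  define W where "W k t = (\<lambda>i. if i < k then V t i else V t0 i)" for k t
  have "((\<lambda>t. \<phi> (W k t)) has_real_derivative (\<Sum>i<k. p i (V t0) * d i)) (at t0)" if "k \<le> m" for k
    using that
  proof (induction k)
    case 0
    then show ?case by (simp add: W_def)
  next
    case (Suc k)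
    then have k: "k < m" by simp
    have W_Suc: "W (Suc k) t = (W k t)(k := V t k)" for t
      by (auto simp: W_def fun_eq_iff less_Suc_eq)
    \<comment> \<open>This trivial update exhibits \<open>W k t\<close> and
      \<open>W (Suc k) t\<close> as two points on the same coordinate line.\<close>
    have W_same: "W k t = (W k t)(k := V t0 k)" for t
      by (auto simp: W_def fun_eq_iff)
    \<comment> \<open>Caratheodory's form of the derivative: \<open>e\<close> is the slope of the
      coordinate, continuous at \<open>t0\<close>. Its product with the partial derivative at the
      intermediate point is the slope of the increment.\<close>
    obtain e where e: "\<And>t. V t k - V t0 k = e t * (t - t0)" "isCont e t0" "e t0 = d k"
      using V[OF k] unfolding CARAT_DERIV by auto
    have "\<exists>\<xi>. min (V t0 k) (V t k) \<le> \<xi> \<and> \<xi> \<le> max (V t0 k) (V t k) \<and>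
        \<phi> (W (Suc k) t) - \<phi> (W k t) = p k ((W k t)(k := \<xi>)) * (V t k - V t0 k)" for t
      using mvt_between[of "\<lambda>s. \<phi> ((W k t)(k := s))" "\<lambda>s. p k ((W k t)(k := s))" "V t0 k" "V t k",
          OF has_partialD[OF p(1)[OF k]]] by (simp only: W_Suc W_same[symmetric])
    then obtain \<xi> where \<xi>: "\<And>t. min (V t0 k) (V t k) \<le> \<xi> t" "\<And>t. \<xi> t \<le> max (V t0 k) (V t k)"
      "\<And>t. \<phi> (W (Suc k) t) - \<phi> (W k t) = p k ((W k t)(k := \<xi> t)) * (V t k - V t0 k)"
      by metis
    have V_lim: "((\<lambda>t. V t i) \<longlongrightarrow> V t0 i) (at t0)" for i
    proof (cases "i < m")
      case True
      then show ?thesis using DERIV_isCont[OF V] by (simp add: isCont_def)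
    next
      case False
      then have "(\<lambda>t. V t i) = (\<lambda>t. V t0 i)" by (intro ext fixed) simp
      then show ?thesis by (metis tendsto_const)
    qed
    have \<xi>0: "\<xi> t0 = V t0 k" using \<xi>(1,2)[of t0] by simp
    have "(\<xi> \<longlongrightarrow> V t0 k) (at t0)"
    proof (rule tendsto_sandwich)
      show "((\<lambda>t. min (V t0 k) (V t k)) \<longlongrightarrow> V t0 k) (at t0)" "((\<lambda>t. max (V t0 k) (V t k)) \<longlongrightarrow> V t0 k) (at t0)"
        using tendsto_min[OF tendsto_const[of "V t0 k"] V_lim[of k]]
          tendsto_max[OF tendsto_const[of "V t0 k"] V_lim[of k]] by simp_all
    qed (use \<xi> in auto)
    then have "((\<lambda>t. ((W k t)(k := \<xi> t)) i) \<longlongrightarrow> V t0 i) (at t0)" for i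
      using V_lim[of i] by (cases "i = k"; cases "i < k") (simp_all add: W_def)
    then have "((\<lambda>t. (W k t)(k := \<xi> t)) \<longlongrightarrow> V t0) (at t0)"
      by (subst tendsto_fun_iff) (rule allI)
    then have "((\<lambda>t. p k ((W k t)(k := \<xi> t))) \<longlongrightarrow> p k (V t0)) (at t0)"
      by (intro continuous_on_tendsto_compose[OF p(2)[OF k]]) auto
    moreover have "(W k t0)(k := \<xi> t0) = V t0" by (auto simp: \<xi>0 W_def fun_eq_iff)
    moreover note W0 = this
    ultimately have "isCont (\<lambda>t. p k ((W k t)(k := \<xi> t)) * e t) t0"
      using e(2) by (auto simp: isCont_def intro!: tendsto_mult)
    then have "((\<lambda>t. \<phi> (W (Suc k) t) - \<phi> (W k t)) has_real_derivative p k (V t0) * d k) (at t0)"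
      unfolding CARAT_DERIV using e \<xi>(3) W0
      by (intro exI[of _ "\<lambda>t. p k ((W k t)(k := \<xi> t)) * e t"]) auto
    from DERIV_add[OF Suc.IH this] Suc.prems show ?case by simp
  qed
  moreover have "W m = V"
    using fixed by (intro ext) (metis W_def not_less)
  ultimately show ?thesis by (metis order_refl)
qed

text \<open>A common regularity class for the two kinds of outer functions, polynomials and
  \<open>smooth_cs\<close>; it is applied with \<open>k = 2\<close>. Continuity refers to the
  product topology.\<close>

primrec Ck :: "nat \<Rightarrow> nat \<Rightarrow> ((nat \<Rightarrow> real) \<Rightarrow> real) \<Rightarrow> bool" where
  "Ck 0 m \<phi> \<longleftrightarrow> continuous_on UNIV \<phi>"
| "Ck (Suc k) m \<phi> \<longleftrightarrow> continuous_on UNIV \<phi> \<and> (\<forall>i<m. \<exists>p. has_partial \<phi> i p \<and> Ck k m p)"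

lemma Ck_continuous: "Ck k m \<phi> \<Longrightarrow> continuous_on UNIV \<phi>"
  by (cases k) auto

lemma poly_funs_has_partial:
  assumes "\<phi> \<in> poly_funs" shows "\<exists>p\<in>poly_funs. has_partial \<phi> i p"
  using assms
proof induction
  case (pconst c)
  then show ?case by (auto intro!: bexI[of _ "\<lambda>v. 0"] poly_funs.pconst simp: has_partial_def)
next
  case (pproj j)
  show ?case
    by (rule bexI[of _ "\<lambda>v. if i = j then 1 else 0"])
      (auto simp: has_partial_def intro!: poly_funs.pconst)
next
  case (padd p q)
  then obtain p' q' where "p' \<in> poly_funs" "has_partial p i p'" "q' \<in> poly_funs" "has_partial q i q'"
    by blast
  then show ?case
    by (intro bexI[of _ "\<lambda>v. p' v + q' v"])
      (auto simp: has_partial_def intro!: poly_funs.padd derivative_intros)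
next
  case (pmult p q)
  then obtain p' q' where *: "p' \<in> poly_funs" "has_partial p i p'" "q' \<in> poly_funs" "has_partial q i q'"
    by blast
  then have "has_partial (\<lambda>v. p v * q v) i (\<lambda>v. p v * q' v + p' v * q v)"
    unfolding has_partial_def by (auto intro!: derivative_eq_intros)
  then show ?case
    using * pmult by (intro bexI[of _ "\<lambda>v. p v * q' v + p' v * q v"]) (auto intro: poly_funs.intros)
qed

lemma poly_funs_Ck: "\<phi> \<in> poly_funs \<Longrightarrow> Ck k m \<phi>"
proof (induction k arbitrary: \<phi>)
  case 0
  then show ?case by (simp, induction) (auto intro!: continuous_intros)
next
  case (Suc k)
  then show ?case using poly_funs_has_partial Suc.IH by (metis Ck.simps(2) Ck_continuous)
qed

text \<open>Formulated for every list of indices because the induction passes from \<open>is\<close>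
  to \<open>i # is\<close>; the empty list gives the function itself.\<close>

lemma smooth_cs_Ck:
  assumes "smooth_cs m \<phi>" "set is \<subseteq> {..<m}"
  shows "Ck k m (iter_partial is \<phi>)"
  using assms(2)
proof (induction k arbitrary: "is")
  case 0
  then show ?case using assms(1) by (simp add: smooth_cs_def)
next
  case (Suc k)
  have "has_partial (iter_partial is \<phi>) i (iter_partial (i # is) \<phi>)" if "i < m" for i
    using assms(1) Suc.prems that
    by (auto simp: smooth_cs_def has_partial_def partial_i_def DERIV_deriv_iff_real_differentiable)
  moreover have "Ck k m (iter_partial (i # is) \<phi>)" if "i < m" for i
    using Suc that by (intro Suc.IH) auto
  moreover have "continuous_on UNIV (iter_partial is \<phi>)"
    using assms(1) Suc.prems by (simp add: smooth_cs_def)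
  ultimately show ?case by auto
qed

section \<open>Gradients and Hessians of cylinder functions\<close>

text \<open>Linearity is restricted to \<open>D\<close> because \<open>gen T\<close> is defined by a
  \<open>Lim\<close> whose value is unspecified outside \<open>gen_dom T\<close>.\<close>

definition linear_on :: "'b::real_vector set \<Rightarrow> ('b \<Rightarrow> 'c::real_vector) \<Rightarrow> bool" where
  "linear_on D k \<longleftrightarrow> (\<forall>g\<in>D. \<forall>h\<in>D. k (g + h) = k g + k h) \<and> (\<forall>c. \<forall>g\<in>D. k (c *\<^sub>R g) = c *\<^sub>R k g)"

lemma linear_on_add: "linear_on D k \<Longrightarrow> g \<in> D \<Longrightarrow> h \<in> D \<Longrightarrow> k (g + h) = k g + k h"
  and linear_on_scaleR: "linear_on D k \<Longrightarrow> g \<in> D \<Longrightarrow> k (c *\<^sub>R g) = c *\<^sub>R k g"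
  by (simp_all add: linear_on_def)

lemma linear_on_zero: "subspace D \<Longrightarrow> linear_on D k \<Longrightarrow> k 0 = 0"
  using linear_on_scaleR[of D k 0 0] by (simp add: subspace_0)

lemma linear_on_compose: "linear_on D k \<Longrightarrow> linear f \<Longrightarrow> linear_on D (\<lambda>g. f (k g))"
  by (simp add: linear_on_def linear_add linear_scale)

lemma linear_on_sum:
  assumes D: "subspace D" and k: "linear_on D k" and g: "\<And>i. i \<in> I \<Longrightarrow> g i \<in> D"
  shows "k (\<Sum>i\<in>I. c i *\<^sub>R g i) = (\<Sum>i\<in>I. c i *\<^sub>R k (g i))"
  using g
proof (induction I rule: infinite_finite_induct)
  case (insert i I)
  have "(\<Sum>i\<in>I. c i *\<^sub>R g i) \<in> D" "c i *\<^sub>R g i \<in> D"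
    using insert.prems by (auto intro!: subspace_sum subspace_scale D)
  with insert show ?case
    by (simp add: linear_on_add[OF k] linear_on_scaleR[OF k])
qed (simp_all add: linear_on_zero[OF D k])

text \<open>Bilinear forms on functionals induced by the elements of \<open>D \<otimes> D\<close>.\<close>
definition square_forms :: "'b set \<Rightarrow> (('b \<Rightarrow> real) \<Rightarrow> ('b \<Rightarrow> real) \<Rightarrow> real) set" where
  "square_forms D = {B. \<exists>xs. set xs \<subseteq> UNIV \<times> D \<and> B = (\<lambda>k h. \<Sum>(c, g)\<leftarrow>xs. c * k g * h g)}"

lemma square_forms_zero: "(\<lambda>k h. 0) \<in> square_forms D"
  unfolding square_forms_def by (auto intro!: exI[of _ "[]"])

lemma square_forms_single: "g \<in> D \<Longrightarrow> (\<lambda>k h. c * k g * h g) \<in> square_forms D"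
  unfolding square_forms_def by (auto intro!: exI[of _ "[(c, g)]"])

lemma square_forms_add:
  assumes "B \<in> square_forms D" "C \<in> square_forms D"
  shows "(\<lambda>k h. B k h + C k h) \<in> square_forms D"
proof -
  obtain xs ys where "set xs \<subseteq> UNIV \<times> D" "B = (\<lambda>k h. \<Sum>(c, g)\<leftarrow>xs. c * k g * h g)"
    "set ys \<subseteq> UNIV \<times> D" "C = (\<lambda>k h. \<Sum>(c, g)\<leftarrow>ys. c * k g * h g)"
    using assms unfolding square_forms_def by blast
  then show ?thesis
    unfolding square_forms_def by (auto intro!: exI[of _ "xs @ ys"])
qed

lemma square_forms_scale:
  assumes "B \<in> square_forms D" shows "(\<lambda>k h. a * B k h) \<in> square_forms D"
proof -
  obtain xs where "set xs \<subseteq> UNIV \<times> D" "B = (\<lambda>k h. \<Sum>(c, g)\<leftarrow>xs. c * k g * h g)"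
    using assms unfolding square_forms_def by blast
  then show ?thesis
    unfolding square_forms_def
    by (intro CollectI exI[of _ "map (\<lambda>(c, g). (a * c, g)) xs"])
      (force simp: sum_list_const_mult[symmetric] case_prod_beta comp_def mult.assoc)
qed

lemma square_forms_sum:
  "(\<And>i. i \<in> I \<Longrightarrow> B i \<in> square_forms D) \<Longrightarrow> (\<lambda>k h. \<Sum>i\<in>I. B i k h) \<in> square_forms D"
  by (induction I rule: infinite_finite_induct) (auto intro: square_forms_zero square_forms_add)

text \<open>By polarization, which is why \<open>k\<close> and \<open>h\<close> have to be linear on \<open>D\<close>.\<close>
lemma symmetric_form_square_forms:
  fixes D :: "'b::real_vector set"
  assumes D: "subspace D" and g: "\<And>i. i < m \<Longrightarrow> g i \<in> D"
    and sym: "\<And>i j. i < m \<Longrightarrow> j < m \<Longrightarrow> q i j = q j i"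
  shows "\<exists>B\<in>square_forms D. \<forall>k h. linear_on D k \<longrightarrow> linear_on D h \<longrightarrow>
    B k h = (\<Sum>i<m. \<Sum>j<m. q i j * k (g i) * h (g j))"
proof
  \<comment> \<open>For linear \<open>k\<close> and \<open>h\<close> the three squares leave half
    the sum of the two cross terms \<open>k (g i) * h (g j)\<close> and
    \<open>k (g j) * h (g i)\<close>. Symmetry of \<open>q\<close> makes both contribute equally to
    the double sum.\<close>
  let ?B = "\<lambda>(k :: 'b \<Rightarrow> real) (h :: 'b \<Rightarrow> real). \<Sum>i<m. \<Sum>j<m.
    q i j / 2 * k (g i + g j) * h (g i + g j) + (- q i j / 2 * k (g i) * h (g i) + - q i j / 2 * k (g j) * h (g j))"
  show "?B \<in> square_forms D"
    using g by (intro square_forms_sum square_forms_add square_forms_single) (auto intro: subspace_add D)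
  show "\<forall>k h. linear_on D k \<longrightarrow> linear_on D h \<longrightarrow>
    ?B k h = (\<Sum>i<m. \<Sum>j<m. q i j * k (g i) * h (g j))"
  proof (intro allI impI)
    fix k h :: "'b \<Rightarrow> real"
    assume lin: "linear_on D k" "linear_on D h"
    have "?B k h = (\<Sum>i<m. \<Sum>j<m. q i j * k (g i) * h (g j) / 2 + q i j * k (g j) * h (g i) / 2)"
      by (intro sum.cong refl)
        (simp add: linear_on_add[OF lin(1)] linear_on_add[OF lin(2)] g field_simps)
    also have "\<dots> = (\<Sum>i<m. \<Sum>j<m. q i j * k (g i) * h (g j) / 2) + (\<Sum>i<m. \<Sum>j<m. q i j * k (g j) * h (g i) / 2)"
      by (simp add: sum.distrib)
    also have "(\<Sum>i<m. \<Sum>j<m. q i j * k (g j) * h (g i) / 2) = (\<Sum>j<m. \<Sum>i<m. q i j * k (g j) * h (g i) / 2)"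
      by (rule sum.swap)
    also have "\<dots> = (\<Sum>j<m. \<Sum>i<m. q j i * k (g j) * h (g i) / 2)"
      by (intro sum.cong refl) (simp add: sym)
    finally show "?B k h = (\<Sum>i<m. \<Sum>j<m. q i j * k (g i) * h (g j))"
      by (simp flip: sum_divide_distrib)
  qed
qed

text \<open>\<open>F\<close> has gradient \<open>\<gamma>\<close> with values in \<open>D\<close> and Hessian \<open>B\<close> with values in \<open>D \<otimes> D\<close>, in the sense
  of a chain rule along curves \<open>L\<close> of functionals. In the second derivative the gradient is paired with
  a functional \<open>k\<close> which itself varies along a curve.\<close>
definition has_grad_hess ::
  "('b::real_vector) set \<Rightarrow> (('b \<Rightarrow> real) \<Rightarrow> real) \<Rightarrow> (('b \<Rightarrow> real) \<Rightarrow> 'b) \<Rightarrow>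
    (('b \<Rightarrow> real) \<Rightarrow> ('b \<Rightarrow> real) \<Rightarrow> ('b \<Rightarrow> real) \<Rightarrow> real) \<Rightarrow> bool" where
  "has_grad_hess D F \<gamma> B \<longleftrightarrow> (\<forall>l. \<gamma> l \<in> D \<and> B l \<in> square_forms D) \<and>
    (\<forall>L L' k k' t. linear_on D L' \<longrightarrow> (\<forall>s. linear_on D (k s)) \<longrightarrow> linear_on D k' \<longrightarrow>
      (\<forall>g\<in>D. ((\<lambda>s. L s g) has_real_derivative L' g) (at t)) \<longrightarrow>
      (\<forall>g\<in>D. ((\<lambda>s. k s g) has_real_derivative k' g) (at t)) \<longrightarrow>
      ((\<lambda>s. F (L s)) has_real_derivative L' (\<gamma> (L t))) (at t) \<and>
      ((\<lambda>s. k s (\<gamma> (L s))) has_real_derivative k' (\<gamma> (L t)) + B (L t) (k t) L') (at t))"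

lemma has_grad_hess_const:
  assumes "subspace D" shows "has_grad_hess D (\<lambda>l. 0) (\<lambda>l. 0) (\<lambda>l k h. 0)"
proof -
  have "((\<lambda>s. 0) has_real_derivative k 0) (at t)" if "linear_on D k" for k :: "'a \<Rightarrow> real" and t :: real
    unfolding linear_on_zero[OF assms that] by (rule DERIV_const)
  then show ?thesis
    using assms by (simp add: has_grad_hess_def square_forms_zero subspace_0 linear_on_zero)
qed

lemma has_grad_hess_add:
  assumes D: "subspace D" and FG: "has_grad_hess D F \<gamma> B" "has_grad_hess D G \<delta> C"
  shows "has_grad_hess D (\<lambda>l. F l + G l) (\<lambda>l. \<gamma> l + \<delta> l) (\<lambda>l k h. B l k h + C l k h)"
proof -
  have mem: "\<gamma> l \<in> D" "\<delta> l \<in> D" for l using FG by (auto simp: has_grad_hess_def)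
  show ?thesis
    unfolding has_grad_hess_def
  proof (intro conjI allI impI)
    show "\<gamma> l + \<delta> l \<in> D" for l using mem D by (simp add: subspace_add)
    show "(\<lambda>k h. B l k h + C l k h) \<in> square_forms D" for l
      using FG by (intro square_forms_add) (auto simp: has_grad_hess_def)
    fix L L' and k :: "real \<Rightarrow> 'a \<Rightarrow> real" and k' t
    assume *: "linear_on D L'" "\<forall>s. linear_on D (k s)" "linear_on D k'"
      "\<forall>g\<in>D. ((\<lambda>s. L s g) has_real_derivative L' g) (at t)"
      "\<forall>g\<in>D. ((\<lambda>s. k s g) has_real_derivative k' g) (at t)"
    have lin: "L' (\<gamma> l + \<delta> l) = L' (\<gamma> l) + L' (\<delta> l)" "k s (\<gamma> l + \<delta> l) = k s (\<gamma> l) + k s (\<delta> l)"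
      "k' (\<gamma> l + \<delta> l) = k' (\<gamma> l) + k' (\<delta> l)" for s l
      using * mem by (auto intro: linear_on_add)
    note der = FG[unfolded has_grad_hess_def, THEN conjunct2, rule_format, OF *[rule_format]]
    show "((\<lambda>s. F (L s) + G (L s)) has_real_derivative L' (\<gamma> (L t) + \<delta> (L t))) (at t)"
      unfolding lin by (intro DERIV_add der[THEN conjunct1])
    show "((\<lambda>s. k s (\<gamma> (L s) + \<delta> (L s))) has_real_derivative
        k' (\<gamma> (L t) + \<delta> (L t)) + (B (L t) (k t) L' + C (L t) (k t) L')) (at t)"
      using DERIV_add[OF der(1)[THEN conjunct2] der(2)[THEN conjunct2]]
      unfolding lin by (simp add: add_ac)
  qed
qed

lemma has_grad_hess_scale:
  assumes D: "subspace D" and F: "has_grad_hess D F \<gamma> B"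
  shows "has_grad_hess D (\<lambda>l. a * F l) (\<lambda>l. a *\<^sub>R \<gamma> l) (\<lambda>l k h. a * B l k h)"
proof -
  have mem: "\<gamma> l \<in> D" for l using F by (auto simp: has_grad_hess_def)
  show ?thesis
    unfolding has_grad_hess_def
  proof (intro conjI allI impI)
    show "a *\<^sub>R \<gamma> l \<in> D" for l using mem D by (simp add: subspace_scale)
    show "(\<lambda>k h. a * B l k h) \<in> square_forms D" for l
      using F by (intro square_forms_scale) (auto simp: has_grad_hess_def)
    fix L L' and k :: "real \<Rightarrow> 'a \<Rightarrow> real" and k' t
    assume *: "linear_on D L'" "\<forall>s. linear_on D (k s)" "linear_on D k'"
      "\<forall>g\<in>D. ((\<lambda>s. L s g) has_real_derivative L' g) (at t)"
      "\<forall>g\<in>D. ((\<lambda>s. k s g) has_real_derivative k' g) (at t)"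
    have lin: "L' (a *\<^sub>R \<gamma> l) = a * L' (\<gamma> l)" "k s (a *\<^sub>R \<gamma> l) = a * k s (\<gamma> l)"
      "k' (a *\<^sub>R \<gamma> l) = a * k' (\<gamma> l)" for s l
      using *(1-3) mem by (auto simp: linear_on_def)
    note der = F[unfolded has_grad_hess_def, THEN conjunct2, rule_format, OF *[rule_format]]
    show "((\<lambda>s. a * F (L s)) has_real_derivative L' (a *\<^sub>R \<gamma> (L t))) (at t)"
      unfolding lin by (intro DERIV_cmult der[THEN conjunct1])
    show "((\<lambda>s. k s (a *\<^sub>R \<gamma> (L s))) has_real_derivative
        k' (a *\<^sub>R \<gamma> (L t)) + a * B (L t) (k t) L') (at t)"
      using DERIV_cmult[OF der[THEN conjunct2], of a]
      unfolding lin by (simp add: distrib_left)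
  qed
qed

text \<open>The gradient is the combination of the \<open>g i\<close> with the first partials of
  \<phi> as coefficients, and the Hessian has the second partials as its matrix. Equality of mixed
  partials makes that matrix symmetric, so polarization puts the Hessian into
  \<open>square_forms D\<close>.\<close>

lemma has_grad_hess_cylindrical:
  assumes D: "subspace D" and g: "\<And>i. i < m \<Longrightarrow> g i \<in> D" and \<phi>: "Ck 2 m \<phi>"
  shows "\<exists>\<gamma> B. has_grad_hess D (\<lambda>l. \<phi> (\<lambda>i. if i < m then l (g i) else 0)) \<gamma> B"
proof -
  have "\<forall>i<m. \<exists>p. has_partial \<phi> i p \<and> Ck (Suc 0) m p"
    using \<phi> by (simp add: numeral_2_eq_2)
  then obtain p where p: "\<And>i. i < m \<Longrightarrow> has_partial \<phi> i (p i)" "\<And>i. i < m \<Longrightarrow> Ck (Suc 0) m (p i)"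
    by metis
  then have "\<forall>i<m. \<forall>j<m. \<exists>q. has_partial (p i) j q \<and> continuous_on UNIV q" by simp
  then obtain q where q: "\<And>i j. i < m \<Longrightarrow> j < m \<Longrightarrow> has_partial (p i) j (q i j)"
    "\<And>i j. i < m \<Longrightarrow> j < m \<Longrightarrow> continuous_on UNIV (q i j)"
    by metis
  have sym: "q i j v = q j i v" if "i < m" "j < m" for i j v
    by (rule has_partial_commute[OF p(1) p(1) q(1) q(1) q(2) q(2)]) (use that in simp_all)
  define V where "V l = (\<lambda>i. if i < m then l (g i) else 0)" for l :: "'a \<Rightarrow> real"
  define \<gamma> where "\<gamma> l = (\<Sum>i<m. p i (V l) *\<^sub>R g i)" for l
  have "\<exists>B. \<forall>l. B l \<in> square_forms D \<and> (\<forall>k h. linear_on D k \<longrightarrow> linear_on D h \<longrightarrow>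
      B l k h = (\<Sum>i<m. \<Sum>j<m. q i j (V l) * k (g i) * h (g j)))"
    by (rule choice, rule allI, rule symmetric_form_square_forms[OF D g sym, unfolded Bex_def])
  then obtain B where B: "\<And>l. B l \<in> square_forms D"
    "\<And>l k h. linear_on D k \<Longrightarrow> linear_on D h \<Longrightarrow>
      B l k h = (\<Sum>i<m. \<Sum>j<m. q i j (V l) * k (g i) * h (g j))"
    by blast
  have "has_grad_hess D (\<lambda>l. \<phi> (V l)) \<gamma> B"
    unfolding has_grad_hess_def
  proof (intro conjI allI impI)
    show "\<gamma> l \<in> D" for l unfolding \<gamma>_def by (intro subspace_sum subspace_scale D g) simp
    show "B l \<in> square_forms D" for l by (rule B)
    fix L L' and k :: "real \<Rightarrow> 'a \<Rightarrow> real" and k' t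
    assume *: "linear_on D L'" "\<forall>s. linear_on D (k s)" "linear_on D k'"
      "\<forall>g\<in>D. ((\<lambda>s. L s g) has_real_derivative L' g) (at t)"
      "\<forall>g\<in>D. ((\<lambda>s. k s g) has_real_derivative k' g) (at t)"
    have pair: "h (\<gamma> l) = (\<Sum>i<m. p i (V l) * h (g i))" if "linear_on D h" for h l
      unfolding \<gamma>_def using linear_on_sum[OF D that, of "{..<m}" g] g by simp
    have V: "((\<lambda>s. V (L s) i) has_real_derivative L' (g i)) (at t)" if "i < m" for i
      using *(4) g that by (simp add: V_def)
    have V_const: "V (L s) i = V (L t) i" if "i \<ge> m" for s i
      using that by (simp add: V_def)
    show "((\<lambda>s. \<phi> (V (L s))) has_real_derivative L' (\<gamma> (L t))) (at t)"
      unfolding pair[OF *(1)]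
      by (rule chain_rule_coordinates[OF p(1) Ck_continuous[OF p(2)] V V_const])
    \<comment> \<open>Second chain rule, now for the coefficients of the gradient; the product rule
      with the moving functional \<open>k s\<close> then yields both terms of the claim.\<close>
    have "((\<lambda>s. p i (V (L s))) has_real_derivative (\<Sum>j<m. q i j (V (L t)) * L' (g j))) (at t)"
      if "i < m" for i
      by (rule chain_rule_coordinates[OF q[OF that] V V_const])
    then have "((\<lambda>s. \<Sum>i<m. p i (V (L s)) * k s (g i)) has_real_derivative
        (\<Sum>i<m. (\<Sum>j<m. q i j (V (L t)) * L' (g j)) * k t (g i) + k' (g i) * p i (V (L t)))) (at t)"
      using *(5) g by (intro DERIV_sum DERIV_mult) auto
    also have "(\<lambda>s. \<Sum>i<m. p i (V (L s)) * k s (g i)) = (\<lambda>s. k s (\<gamma> (L s)))"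
      using *(2) by (simp add: pair)
    also have "(\<Sum>i<m. (\<Sum>j<m. q i j (V (L t)) * L' (g j)) * k t (g i) + k' (g i) * p i (V (L t))) =
        k' (\<gamma> (L t)) + B (L t) (k t) L'"
      using * by (simp add: pair B(2) sum.distrib sum_distrib_left sum_distrib_right mult_ac)
    finally show "((\<lambda>s. k s (\<gamma> (L s))) has_real_derivative k' (\<gamma> (L t)) + B (L t) (k t) L') (at t)" .
  qed
  then show ?thesis unfolding V_def by blast
qed

lemma cylD_has_grad_hess:
  assumes D: "subspace D" and F: "F \<in> cylD D"
  shows "\<exists>\<gamma> B. has_grad_hess D F \<gamma> B"
proof -
  obtain n :: nat and c G where G: "\<And>j. j < n \<Longrightarrow> G j \<in> cyl_gen D" and F: "F = (\<lambda>l. \<Sum>j<n. c j * G j l)"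
    using F by (auto simp: cylD_def)
  have gen: "\<exists>\<gamma> B. has_grad_hess D (G j) \<gamma> B" if j: "j < n" for j
  proof -
    obtain m g \<phi> where *: "\<And>i. i < m \<Longrightarrow> g i \<in> D" "\<phi> \<in> poly_funs \<or> smooth_cs m \<phi>"
      "G j = (\<lambda>l. \<phi> (\<lambda>i. if i < m then l (g i) else 0))"
      using G[OF j] unfolding cyl_gen_def by blast
    have "Ck 2 m \<phi>" using *(2) poly_funs_Ck smooth_cs_Ck[of m \<phi> "[]"] by auto
    then show ?thesis unfolding *(3) by (intro has_grad_hess_cylindrical D *(1))
  qed
  have "\<exists>\<gamma> B. has_grad_hess D (\<lambda>l. \<Sum>j<r. c j * G j l) \<gamma> B" if "r \<le> n" for r
    using that
  proof (induction r)
    case 0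
    then show ?case using has_grad_hess_const[OF D] by auto
  next
    case (Suc r)
    then obtain \<gamma> B \<delta> C where "has_grad_hess D (\<lambda>l. \<Sum>j<r. c j * G j l) \<gamma> B" "has_grad_hess D (G r) \<delta> C"
      using gen[of r] by auto
    then show ?case
      using has_grad_hess_add[OF D _ has_grad_hess_scale[OF D]] by (simp, blast)
  qed
  then show ?thesis unfolding F by blast
qed

section \<open>Identification with \<open>grad\<close> and \<open>hess\<close>, and the operator on
  tensors\<close>

lemma linear_on_eval: "linear_on D (\<lambda>g :: 'a::topological_space \<Rightarrow>\<^sub>C real. apply_bcontfun g x)"
  by (simp add: linear_on_def)

lemma dder_eqI:
  fixes F :: "(('a::topological_space \<Rightarrow>\<^sub>C real) \<Rightarrow> real) \<Rightarrow> real"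
  assumes "((\<lambda>s. F (\<lambda>g. l g + s * apply_bcontfun g x)) has_real_derivative d) (at 0)"
  shows "dder F l x = d"
proof -
  have "((\<lambda>\<epsilon>. (F (\<lambda>g. l g + \<epsilon> * g x) - F l) / \<epsilon>) \<longlongrightarrow> d) (at 0)"
    using assms unfolding DERIV_def by simp
  then show ?thesis unfolding dder_def by (intro tendsto_Lim) simp_all
qed

text \<open>The defining limits are derivatives along the lines \<open>l + s \<delta>_x\<close>. For
  the Hessian the gradient is paired with the constant functional of evaluation at \<open>y\<close>,
  whose derivative \<open>k'\<close> is 0.\<close>

lemma dder_hess_eq:
  fixes F :: "(('a::topological_space \<Rightarrow>\<^sub>C real) \<Rightarrow> real) \<Rightarrow> real"
  assumes "has_grad_hess D F \<gamma> B"
  shows "dder F l x = apply_bcontfun (\<gamma> l) x"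
    and "hess F l (x, y) = B l (\<lambda>g. apply_bcontfun g y) (\<lambda>g. apply_bcontfun g x)"
proof -
  define L where "L l x s = (\<lambda>g. l g + s * apply_bcontfun g x)"
    for l :: "('a \<Rightarrow>\<^sub>C real) \<Rightarrow> real" and x s
  have L0: "L l x 0 = l" for l x by (simp add: L_def)
  have L: "((\<lambda>s. L l x s g) has_real_derivative apply_bcontfun g x) (at 0)" for l g x
    unfolding L_def by (auto intro!: derivative_eq_intros)
  note chain = assms[unfolded has_grad_hess_def, THEN conjunct2, rule_format]
  have der: "((\<lambda>s. F (L l x s)) has_real_derivative \<gamma> l x) (at 0) \<and>
      ((\<lambda>s. \<gamma> (L l x s) y) has_real_derivative
        B l (\<lambda>g. apply_bcontfun g y) (\<lambda>g. apply_bcontfun g x)) (at 0)" for l x y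
    using chain[of "\<lambda>g. apply_bcontfun g x" "\<lambda>_ g. apply_bcontfun g y" "\<lambda>_. 0" "L l x" 0]
    by (simp add: L L0 linear_on_eval linear_on_def[of D "\<lambda>_. 0"])
  show dder: "dder F l x = \<gamma> l x" for l x
    using der[THEN conjunct1] unfolding L_def by (rule dder_eqI)
  have "((\<lambda>s. dder F (L l x s) y) has_real_derivative
      B l (\<lambda>g. apply_bcontfun g y) (\<lambda>g. apply_bcontfun g x)) (at 0)"
    unfolding dder by (rule der[THEN conjunct2])
  then show "hess F l (x, y) = B l (\<lambda>g. apply_bcontfun g y) (\<lambda>g. apply_bcontfun g x)"
    unfolding hess_def L_def by (simp add: dder_eqI)
qed

lemma grad_eq:
  fixes F :: "(('a::topological_space \<Rightarrow>\<^sub>C real) \<Rightarrow> real) \<Rightarrow> real"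
  assumes "has_grad_hess D F \<gamma> B" shows "grad F l = \<gamma> l"
  unfolding grad_def dder_hess_eq(1)[OF assms] by (rule apply_bcontfun_inverse)

text \<open>Applying \<open>A\<close> in one variable at a time shows that \<open>(A \<otimes> A) H\<close> does not depend on the
  representation of \<open>H\<close>.\<close>
lemma tensor_op_eq:
  fixes D :: "('a::topological_space \<Rightarrow>\<^sub>C real) set" and n :: nat
  assumes D: "subspace D" and A: "linear_on D A" and g: "\<And>i. i < n \<Longrightarrow> g i \<in> D"
  shows "tensor_op D A (\<lambda>(x, y). \<Sum>i<n. c i * apply_bcontfun (g i) x * apply_bcontfun (g i) y) =
    (\<lambda>(x, y). \<Sum>i<n. c i * apply_bcontfun (A (g i)) x * apply_bcontfun (A (g i)) y)"
    (is "tensor_op D A ?H = ?K")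
proof -
  let ?P = "\<lambda>K. \<exists>(n::nat) (c::nat \<Rightarrow> real) g. (\<forall>i<n. g i \<in> D) \<and>
      ?H = (\<lambda>(x, y). \<Sum>i<n. c i * apply_bcontfun (g i) x * apply_bcontfun (g i) y) \<and>
      K = (\<lambda>(x, y). \<Sum>i<n. c i * apply_bcontfun (A (g i)) x * apply_bcontfun (A (g i)) y)"
  have "?P ?K" using g by blast
  moreover have "K = ?K" if "?P K" for K
  proof -
    obtain n' :: nat and c' g' where g': "\<And>i. i < n' \<Longrightarrow> g' i \<in> D"
      and H: "?H = (\<lambda>(x, y). \<Sum>i<n'. c' i * apply_bcontfun (g' i) x * apply_bcontfun (g' i) y)"
      and K: "K = (\<lambda>(x, y). \<Sum>i<n'. c' i * apply_bcontfun (A (g' i)) x * apply_bcontfun (A (g' i)) y)"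
      using \<open>?P K\<close> by blast
    have eval_sum: "apply_bcontfun (\<Sum>i<m. a i *\<^sub>R f i) x = (\<Sum>i<m. a i * f i x)"
      for m :: nat and a and f :: "nat \<Rightarrow> 'a \<Rightarrow>\<^sub>C real" and x
      by (induction m) simp_all
    have apply_A: "(\<Sum>i<n. a i * apply_bcontfun (A (g i)) y) = (\<Sum>i<n'. a' i * apply_bcontfun (A (g' i)) y)"
      if "\<And>x. (\<Sum>i<n. a i * g i x) = (\<Sum>i<n'. a' i * g' i x)" for a a' y
    proof -
      have "(\<Sum>i<n. a i *\<^sub>R g i) = (\<Sum>i<n'. a' i *\<^sub>R g' i)"
        by (rule bcontfun_eqI) (simp add: eval_sum that)
      then have "(\<Sum>i<n. a i *\<^sub>R A (g i)) = (\<Sum>i<n'. a' i *\<^sub>R A (g' i))"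
        using linear_on_sum[OF D A, of "{..<n}" g a] linear_on_sum[OF D A, of "{..<n'}" g' a'] g g' by simp
      then show ?thesis by (simp flip: eval_sum)
    qed
    have "(\<Sum>i<n. c i * g i x * g i y) = (\<Sum>i<n'. c' i * g' i x * g' i y)" for x y
      using fun_cong[OF H, of "(x, y)"] by simp
    \<comment> \<open>In this first use \<open>x\<close> is frozen inside the coefficients and
      \<open>A\<close> acts in \<open>y\<close>; after reordering the factors, the second use
      freezes \<open>y\<close> and acts in \<open>x\<close>.\<close>
    from apply_A[OF this]
    have "(\<Sum>i<n. (c i * apply_bcontfun (A (g i)) y) * g i x) =
        (\<Sum>i<n'. (c' i * apply_bcontfun (A (g' i)) y) * g' i x)" for x y
      by (simp add: mult_ac)
    from apply_A[OF this]
    show ?thesis unfolding K by (auto simp: fun_eq_iff mult_ac)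
  qed
  ultimately show ?thesis
    unfolding tensor_op_def by (rule some_equality)
qed

lemma pair2_sum_squares:
  fixes \<mu> :: "'a::metric_space measure" and g :: "nat \<Rightarrow> 'a \<Rightarrow>\<^sub>C real"
  assumes "\<mu> \<in> Mplus"
  shows "pair2 (\<lambda>(x, y). \<Sum>i<n. c i * g i x * g i y) \<mu> = (\<Sum>i<n. c i * ell \<mu> (g i) * ell \<mu> (g i))"
  using ell_integrable[OF assms] by (simp add: pair2_def ell_def)

section \<open>The maximum principle\<close>

lemma linear_on_gen:
  assumes T: "strongly_continuous_group T"
  shows "linear_on (gen_dom T) (gen T)"
proof -
  have lin: "linear (T s)" for s
    using T by (simp add: strongly_continuous_group_def bounded_linear.linear)
  have gen_eqI: "gen T g = L" if "((\<lambda>h. (1 / h) *\<^sub>R (T h g - g)) \<longlongrightarrow> L) (at_right 0)" for g L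
    unfolding gen_def by (rule tendsto_Lim[OF trivial_limit_at_right_real that])
  show ?thesis
    unfolding linear_on_def
  proof (intro conjI ballI allI)
    fix g h assume "g \<in> gen_dom T" "h \<in> gen_dom T"
    from tendsto_add[OF gen_tendsto[OF this(1)] gen_tendsto[OF this(2)]]
    show "gen T (g + h) = gen T g + gen T h"
      by (intro gen_eqI) (simp add: linear_add[OF lin] algebra_simps)
  next
    fix c g assume "g \<in> gen_dom T"
    from tendsto_scaleR[OF tendsto_const gen_tendsto[OF this], of c]
    show "gen T (c *\<^sub>R g) = c *\<^sub>R gen T g"
      by (intro gen_eqI) (simp add: linear_scale[OF lin] algebra_simps)
  qed
qed

lemma linear_on_subset: "linear_on D k \<Longrightarrow> C \<subseteq> D \<Longrightarrow> linear_on C k"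
  unfolding linear_on_def by blast

lemma linear_on_compose_on:
  "linear_on D f \<Longrightarrow> linear_on E k \<Longrightarrow> f ` D \<subseteq> E \<Longrightarrow> linear_on D (\<lambda>g. k (f g))"
  unfolding linear_on_def by (simp add: image_subset_iff)

text \<open>The first derivative vanishes at the maximum. A positive second derivative would make
  \<open>u'\<close> positive just to the right of \<open>t\<close>, so \<open>u\<close> would exceed
  its maximum there by the mean value theorem.\<close>

lemma second_derivative_le_0_at_max:
  fixes u u' :: "real \<Rightarrow> real"
  assumes u: "\<And>s. (u has_real_derivative u' s) (at s)"
    and u': "(u' has_real_derivative D) (at t)"
    and max: "\<And>s. u s \<le> u t"
  shows "D \<le> 0"
proof (rule ccontr)
  assume "\<not> D \<le> 0"
  have "u' t = 0"
    using DERIV_local_max[OF u, of 1 t] max by simp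
  then obtain d where d: "d > 0" "\<And>h. h > 0 \<Longrightarrow> h < d \<Longrightarrow> u' (t + h) > 0"
    using DERIV_pos_inc_right[OF u'] \<open>\<not> D \<le> 0\<close> by auto
  obtain z where z: "t < z" "z < t + d / 2" "u (t + d / 2) - u t = d / 2 * u' z"
    using MVT2[of t "t + d / 2" u u'] u d(1) by auto
  have "u' z > 0" using d(2)[of "z - t"] z d(1) by simp
  then show False using z(3) d(1) max[of "t + d / 2"] by (smt (verit) divide_pos_pos mult_pos_pos)
qed

text \<open>The inverse of \<open>T s\<close> is \<open>T (- s)\<close>, which is again positive
  since positivity is assumed at all real times.\<close>

lemma positive_automorphism_group:
  fixes T :: "real \<Rightarrow> ('a::metric_space \<Rightarrow>\<^sub>C real) \<Rightarrow> ('a \<Rightarrow>\<^sub>C real)"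
  assumes "compact (UNIV :: 'a set)" "strongly_continuous_group T" "positive_group T"
  shows "positive_automorphism (T s) (T (- s))"
proof (rule positive_automorphism.intro)
  have "T (r + t) = T r \<circ> T t" "T 0 = id" for r t
    using assms by (auto simp: strongly_continuous_group_def)
  from this(1)[of s "- s"] this(1)[of "- s" s] this(2)
  show "T s (T (- s) g) = g" "T (- s) (T s g) = g" for g
    by (auto simp: fun_eq_iff)
qed (use assms in \<open>auto simp: strongly_continuous_group_def positive_group_def bounded_linear.linear\<close>)

theorem theorem3p4:
  fixes D :: "('a::metric_space \<Rightarrow>\<^sub>C real) set"
    and T :: "real \<Rightarrow> ('a \<Rightarrow>\<^sub>C real) \<Rightarrow> ('a \<Rightarrow>\<^sub>C real)"
    and F :: "(('a \<Rightarrow>\<^sub>C real) \<Rightarrow> real) \<Rightarrow> real"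
    and \<nu>s \<mu> :: "'a measure"
  assumes "compact (UNIV :: 'a set)"
    and "subspace D" and "closure D = UNIV" and "const_bcontfun 1 \<in> D"
    and "F \<in> cylD D"
    and "\<nu>s \<in> Mplus" and "\<forall>\<nu>\<in>Mplus. F (ell \<nu>) \<le> F (ell \<nu>s)"
    and "strongly_continuous_group T" and "positive_group T"
    and "D \<subseteq> gen_dom T" and "gen T ` D \<subseteq> gen_dom T"
    and "\<mu> \<in> Mplus" and "meas_le \<mu> \<nu>s" and "supp \<mu> \<subseteq> supp \<nu>s"
  shows "ell \<mu> (gen T (gen T (grad F (ell \<nu>s))))
           + pair2 (tensor_op D (gen T) (hess F (ell \<nu>s))) \<mu> \<le> 0"
proof -
  note D = \<open>subspace D\<close> and T = \<open>strongly_continuous_group T\<close> \<open>positive_group T\<close>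
  obtain \<gamma> B where FB: "has_grad_hess D F \<gamma> B"
    using cylD_has_grad_hess[OF D \<open>F \<in> cylD D\<close>] by blast
  have ell_lin: "linear (ell \<mu>)"
    by (rule bounded_linear.linear[OF bounded_linear_ell[OF \<open>\<mu> \<in> Mplus\<close>]])
  have T_lin: "linear (T s)" and T0: "T 0 = id" for s
    using T by (simp_all add: strongly_continuous_group_def bounded_linear.linear)
  have A_lin: "linear_on D (gen T)"
    using linear_on_gen[OF T(1)] \<open>D \<subseteq> gen_dom T\<close> by (rule linear_on_subset)
  \<comment> \<open>\<open>L s\<close> is integration against the perturbed measure, written without
    constructing it; \<open>L'\<close> is its velocity and \<open>L''\<close> its acceleration at
    time 0.\<close>
  define L where "L s g = ell \<nu>s g - ell \<mu> g + ell \<mu> (T s g)" for s g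
  define L' where "L' s g = ell \<mu> (T s (gen T g))" for s g
  define L'' where "L'' g = ell \<mu> (gen T (gen T g))" for g
  have L0: "L 0 = ell \<nu>s" and L'0: "L' 0 = (\<lambda>g. ell \<mu> (gen T g))"
    by (auto simp: L_def L'_def T0)
  have ell_T: "((\<lambda>s. ell \<mu> (T s g)) has_real_derivative ell \<mu> (T s (gen T g))) (at s)"
    if "g \<in> gen_dom T" for g s
    using bounded_linear.has_vector_derivative[OF bounded_linear_ell[OF \<open>\<mu> \<in> Mplus\<close>]
        group_has_vector_derivative[OF T that]]
    by (simp add: has_real_derivative_iff_has_vector_derivative)
  have L: "((\<lambda>s. L s g) has_real_derivative L' s g) (at s)" if "g \<in> D" for g s
    unfolding L_def L'_def using \<open>D \<subseteq> gen_dom T\<close> that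
    by (auto intro!: derivative_eq_intros ell_T)
  have L': "((\<lambda>s. L' s g) has_real_derivative L'' g) (at 0)" if "g \<in> D" for g
    using ell_T[of "gen T g" 0] \<open>gen T ` D \<subseteq> gen_dom T\<close> that
    by (auto simp: L'_def L''_def T0)
  have L'_lin: "linear_on D (L' s)" for s
    unfolding L'_def by (intro linear_on_compose[OF _ ell_lin] linear_on_compose[OF _ T_lin] A_lin)
  have L''_lin: "linear_on D L''"
    unfolding L''_def
    using linear_on_compose_on[OF A_lin linear_on_gen[OF T(1)] \<open>gen T ` D \<subseteq> gen_dom T\<close>]
    by (rule linear_on_compose[OF _ ell_lin])
  note chain = FB[unfolded has_grad_hess_def, THEN conjunct2, rule_format]
  \<comment> \<open>Only the first half of the chain rule is wanted here, so the paired functional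
    is taken to be 0.\<close>
  have u: "((\<lambda>s. F (L s)) has_real_derivative L' s (\<gamma> (L s))) (at s)" for s
    using chain[of "L' s" "\<lambda>_ _. 0" "\<lambda>_. 0" L s] L L'_lin by (simp add: linear_on_def)
  \<comment> \<open>Now the paired functional is the velocity \<open>L'\<close> itself, so
    differentiating the pairing gives the second derivative of \<open>F\<close> along the
    curve.\<close>
  have u': "((\<lambda>s. L' s (\<gamma> (L s))) has_real_derivative
      L'' (\<gamma> (ell \<nu>s)) + B (ell \<nu>s) (L' 0) (L' 0)) (at 0)"
    using chain[of "L' 0" L' L'' L 0] L L' L'_lin L''_lin by (simp add: L0)
  \<comment> \<open>Maximality of \<open>\<nu>s\<close> applies once \<open>L s\<close> is realized
    by an element of \<open>Mplus\<close>: the measure \<open>\<nu>s - \<mu>\<close> plus the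
    adjoint image of \<open>\<mu>\<close> under \<open>T s\<close>.\<close>
  have "F (L s) \<le> F (L 0)" for s
  proof -
    interpret positive_automorphism "T s" "T (- s)"
      using assms by (intro positive_automorphism_group)
    obtain \<mu>' where "\<mu>' \<in> Mplus" "\<And>g. ell \<mu>' g = ell \<mu> (T s g)"
      using pushforward[OF \<open>\<mu> \<in> Mplus\<close>] by blast
    moreover note diff = add_diff_measure[OF \<open>\<nu>s \<in> Mplus\<close> \<open>\<mu> \<in> Mplus\<close> \<open>meas_le \<mu> \<nu>s\<close>]
    ultimately have "add_measure (diff_measure \<nu>s \<mu>) \<mu>' \<in> Mplus"
      "ell (add_measure (diff_measure \<nu>s \<mu>) \<mu>') = L s"
      by (auto simp: ell_add_measure L_def fun_eq_iff)
    then show ?thesis using assms(7) unfolding L0 by metis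
  qed
  then have le0: "L'' (\<gamma> (ell \<nu>s)) + B (ell \<nu>s) (L' 0) (L' 0) \<le> 0"
    by (rule second_derivative_le_0_at_max[OF u u'])
  obtain xs where xs: "set xs \<subseteq> UNIV \<times> D" "B (ell \<nu>s) = (\<lambda>k h. \<Sum>(c, g)\<leftarrow>xs. c * k g * h g)"
    using FB unfolding has_grad_hess_def square_forms_def by blast
  \<comment> \<open>The list is turned into an indexed sum, the shape in which
    \<open>tensor_op\<close> expects its representation.\<close>
  define n c g where "n = length xs" and "c i = fst (xs ! i)" and "g i = snd (xs ! i)" for i
  have g: "g i \<in> D" if "i < n" for i
    using subsetD[OF xs(1) nth_mem[of i xs]] that by (auto simp: n_def g_def mem_Times_iff)
  have B: "B (ell \<nu>s) k h = (\<Sum>i<n. c i * k (g i) * h (g i))" for k h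
    unfolding xs(2) by (simp add: sum_list_sum_nth n_def c_def g_def case_prod_beta atLeast0LessThan)
  have "hess F (ell \<nu>s) = (\<lambda>(x, y). \<Sum>i<n. c i * g i x * g i y)"
    by (auto simp: fun_eq_iff dder_hess_eq(2)[OF FB] B mult_ac)
  then have "pair2 (tensor_op D (gen T) (hess F (ell \<nu>s))) \<mu> = B (ell \<nu>s) (L' 0) (L' 0)"
    by (simp add: tensor_op_eq[OF D A_lin g] pair2_sum_squares[OF \<open>\<mu> \<in> Mplus\<close>] B L'0)
  then show ?thesis
    using le0 by (simp add: grad_eq[OF FB] L''_def)
qed

end
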